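(* Let $r\ge1$ be an integer, let $G=G(r)\subset W$, and let $N=N(r)=\mathrm{Norm}_W(G(r))$ be its normalizer in $W$. Then the map $$\phi\colon\prod_{i=1}^\infty\mathbb{F}_2\to N,\qquad (k_1,k_2,\ldots)\mapsto w_1^{k_1}w_2^{k_2}\cdots$$ induces (by composition with the projection $N\to N/G$) a group isomorphism $$\bar\phi\colon\prod_{i=1}^\infty\mathbb{F}_2\ \stackrel{\sim}{\longrightarrow}\ N/G.$$
   Context: Tree: $T$ is the regular rooted binary tree whose vertices are the finite words over $\{0,1\}$ (root = empty word; the children of $t$ are $t0,t1$). $W=\mathrm{Aut}(T)$ is the profinite group of automorphisms of $T$ fixing the root. Identifying the subtrees below the vertices $0$ and $1$ with $T$ gives $W=(W\times W)\rtimes\langle\sigma\rangle$, where $(u,v)$ acts by $u$ on the first and by $v$ on the second subtree, and $\sigma$ is the involution interchanging the two subtrees, so $\sigma(u,v)=(v,u)\sigma$. The group $G(r)$: for an integer $r\ge1$, define elements $a_i$ ($i\ge1$) and $b_j$ ($1\le j\le r$) of $W$ as the unique elements satisfying the recursion relations $a_1=\sigma$; $a_{r+1}=(a_r,b_r)$; $a_i=(a_{i-1},1)$ for all $i>1$ with $i\ne r+1$; $b_1=(b_r,b_r^{-1})\sigma$; $b_j=(b_rb_{j-1}b_r^{-1},1)$ for all $1<j\le r$. (Such relations determine unique elements of $W$, level by level.) $G(r)$ is the closure in $W$ of the subgroup generated by all $a_i$ and $b_j$. The elements $w_i$: define recursively $w_1=(1,b_r)$ and $w_{i+1}=(w_i,w_i)$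 for all $i\ge1$. Each $w_i$ has order $2$ and lies in $N(r)$, and the sequence $w_i$ converges to $1$, so the infinite product defining $\phi$ converges in $N(r)$ and $\phi$ is a well-defined continuous map (not itself a homomorphism). *)

theory Defs
  imports "HOL-Analysis.Analysis" "HOL-Algebra.Group_Action" "HOL-Algebra.Product_Groups"
begin

section \<open>The automorphism group of the binary tree\<close>

text \<open>Vertices are finite words over \<open>{0, 1}\<close>, coded as \<open>bool list\<close> with
  \<open>False = 0\<close> and \<open>True = 1\<close>; the root is \<open>[]\<close>.\<close>

definition tree_child :: "bool list \<Rightarrow> bool list \<Rightarrow> bool" where
  "tree_child s t \<longleftrightarrow> (\<exists>x. t = s @ [x])"

definition tree_aut :: "(bool list \<Rightarrow> bool list) \<Rightarrow> bool" where
  "tree_aut g \<longleftrightarrow> bij g \<and> g [] = [] \<and> (\<forall>s t. tree_child s t \<longleftrightarrow> tree_child (g s) (g t))"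

text \<open>Automorphisms act from the left, so \<open>g \<otimes> h\<close> applies \<open>h\<close> first.\<close>

definition AutT :: "(bool list \<Rightarrow> bool list) monoid" where
  "AutT = \<lparr>carrier = {g. tree_aut g}, monoid.mult = (\<circ>), one = id\<rparr>"

text \<open>The profinite topology, i.e. the inverse limit topology of the finite discrete groups
  of automorphisms of the truncated trees, is the topology of pointwise convergence on the
  discrete set of vertices.\<close>

definition AutT_topology :: "(bool list \<Rightarrow> bool list) topology" where
  "AutT_topology =
     subtopology (product_topology (\<lambda>_. discrete_topology UNIV) UNIV) (carrier AutT)"

fun tree_pair ::
    "(bool list \<Rightarrow> bool list) \<Rightarrow> (bool list \<Rightarrow> bool list) \<Rightarrow> bool list \<Rightarrow> bool list" where
  "tree_pair u v [] = []"
| "tree_pair u v (False # t) = False # u t"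
| "tree_pair u v (True # t) = True # v t"

fun tree_swap :: "bool list \<Rightarrow> bool list" where
  "tree_swap [] = []"
| "tree_swap (x # t) = (\<not> x) # t"

section \<open>The group \<open>G(r)\<close> and the elements \<open>w\<^sub>i\<close>\<close>

text \<open>The recursion relations. For \<open>r \<ge> 1\<close> they have exactly one solution
  \<open>(a\<^sub>i)\<close>, \<open>i \<ge> 1\<close>, \<open>(b\<^sub>j)\<close>, \<open>1 \<le> j \<le> r\<close>; see \<open>generator_recursion_exists\<close> and
  \<open>generator_recursion_unique\<close> below. Values at other indices are irrelevant.\<close>

definition generator_recursion ::
    "nat \<Rightarrow> (nat \<Rightarrow> bool list \<Rightarrow> bool list) \<Rightarrow> (nat \<Rightarrow> bool list \<Rightarrow> bool list) \<Rightarrow> bool" where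
  "generator_recursion r a b \<longleftrightarrow>
     (\<forall>i\<ge>1. a i \<in> carrier AutT) \<and>
     (\<forall>j\<in>{1..r}. b j \<in> carrier AutT) \<and>
     a 1 = tree_swap \<and>
     a (r + 1) = tree_pair (a r) (b r) \<and>
     (\<forall>i>1. i \<noteq> r + 1 \<longrightarrow> a i = tree_pair (a (i - 1)) \<one>\<^bsub>AutT\<^esub>) \<and>
     b 1 = tree_pair (b r) (inv\<^bsub>AutT\<^esub> (b r)) \<otimes>\<^bsub>AutT\<^esub> tree_swap \<and>
     (\<forall>j. 1 < j \<and> j \<le> r \<longrightarrow>
        b j = tree_pair (b r \<otimes>\<^bsub>AutT\<^esub> b (j - 1) \<otimes>\<^bsub>AutT\<^esub> inv\<^bsub>AutT\<^esub> (b r)) \<one>\<^bsub>AutT\<^esub>)"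

definition G_group ::
    "nat \<Rightarrow> (nat \<Rightarrow> bool list \<Rightarrow> bool list) \<Rightarrow> (nat \<Rightarrow> bool list \<Rightarrow> bool list)
      \<Rightarrow> (bool list \<Rightarrow> bool list) set" where
  "G_group r a b = AutT_topology closure_of (generate AutT (a ` {1..} \<union> b ` {1..r}))"

definition N_group ::
    "nat \<Rightarrow> (nat \<Rightarrow> bool list \<Rightarrow> bool list) \<Rightarrow> (nat \<Rightarrow> bool list \<Rightarrow> bool list)
      \<Rightarrow> (bool list \<Rightarrow> bool list) set" where
  "N_group r a b = normalizer AutT (G_group r a b)"

text \<open>The sequence \<open>w\<^sub>1, w\<^sub>2, \<dots>\<close> for the parameter \<open>c = b\<^sub>r\<close>; the value at \<open>0\<close> is a dummy.\<close>

fun w_elem :: "(bool list \<Rightarrow> bool list) \<Rightarrow> nat \<Rightarrow> bool list \<Rightarrow> bool list" where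
  "w_elem c 0 = \<one>\<^bsub>AutT\<^esub>"
| "w_elem c (Suc 0) = tree_pair \<one>\<^bsub>AutT\<^esub> c"
| "w_elem c (Suc (Suc i)) = tree_pair (w_elem c (Suc i)) (w_elem c (Suc i))"

text \<open>The additive group \<open>\<Prod>\<^sub>i \<F>\<^sub>2\<close> over \<open>i \<ge> 1\<close>; the exponents \<open>k i\<close> are the
  representatives \<open>0\<close> and \<open>1\<close> in \<open>int\<close>.\<close>

abbreviation F2_product :: "(nat \<Rightarrow> int) monoid" where
  "F2_product \<equiv> product_group {1..} (\<lambda>_. integer_mod_group 2)"

primrec w_partial_product ::
    "(bool list \<Rightarrow> bool list) \<Rightarrow> (nat \<Rightarrow> int) \<Rightarrow> nat \<Rightarrow> bool list \<Rightarrow> bool list" where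
  "w_partial_product c k 0 = \<one>\<^bsub>AutT\<^esub>"
| "w_partial_product c k (Suc n) =
     w_partial_product c k n \<otimes>\<^bsub>AutT\<^esub> (w_elem c (Suc n) [^]\<^bsub>AutT\<^esub> k (Suc n))"

definition w_product ::
    "(bool list \<Rightarrow> bool list) \<Rightarrow> (nat \<Rightarrow> int) \<Rightarrow> bool list \<Rightarrow> bool list" where
  "w_product c k = (THE x. limitin AutT_topology (w_partial_product c k) x sequentially)"

section \<open>The recursion has exactly one solution\<close>

lemma AutT_simps [simp]:
  "carrier AutT = {g. tree_aut g}" "g \<otimes>\<^bsub>AutT\<^esub> h = g \<circ> h" "\<one>\<^bsub>AutT\<^esub> = id"
  by (simp_all add: AutT_def)

lemma tree_aut_id [simp]: "tree_aut id"
  by (simp add: tree_aut_def)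

lemma tree_aut_comp: "tree_aut g \<Longrightarrow> tree_aut h \<Longrightarrow> tree_aut (g \<circ> h)"
  by (simp add: tree_aut_def bij_comp)

lemma tree_aut_inv:
  assumes "tree_aut g" shows "tree_aut (Hilbert_Choice.inv g)"
proof -
  let ?h = "Hilbert_Choice.inv g"
  have b: "bij g" and nil: "g [] = []"
    and child: "tree_child (g s) (g t) \<longleftrightarrow> tree_child s t" for s t
    using assms by (auto simp: tree_aut_def)
  have gh: "g (?h t) = t" for t
    using b by (simp add: bij_is_surj surj_f_inv_f)
  have "?h [] = []"
    using inv_f_f[OF bij_is_inj[OF b], of "[]"] nil by simp
  moreover have "tree_child s t \<longleftrightarrow> tree_child (?h s) (?h t)" for s t
    using child[of "?h s" "?h t"] gh by simp
  ultimately show ?thesis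
    unfolding tree_aut_def using bij_imp_bij_inv[OF b] by blast
qed

lemma tree_aut_inv_comp: "tree_aut g \<Longrightarrow> Hilbert_Choice.inv g \<circ> g = id"
  by (simp add: tree_aut_def bij_is_inj)

lemma group_AutT: "group AutT"
proof (rule groupI)
  fix g assume "g \<in> carrier AutT"
  then show "\<exists>h\<in>carrier AutT. h \<otimes>\<^bsub>AutT\<^esub> g = \<one>\<^bsub>AutT\<^esub>"
    by (intro bexI[of _ "Hilbert_Choice.inv g"]) (simp_all add: tree_aut_inv tree_aut_inv_comp)
qed (auto simp: tree_aut_comp comp_assoc)

lemma inv_AutT:
  assumes "tree_aut g" shows "inv\<^bsub>AutT\<^esub> g = Hilbert_Choice.inv g"
  using assms
  by (intro group.inv_equality[OF group_AutT]) (simp_all add: tree_aut_inv tree_aut_inv_comp)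

lemma tree_aut_child:
  assumes "tree_aut g" shows "\<exists>y. g (t @ [x]) = g t @ [y]"
  using assms unfolding tree_aut_def tree_child_def by metis

lemma tree_aut_length:
  assumes "tree_aut g" shows "length (g t) = length t"
proof (induction t rule: rev_induct)
  case Nil
  then show ?case using assms by (simp add: tree_aut_def)
next
  case (snoc x t)
  then show ?case using tree_aut_child[OF assms, of t x] by auto
qed

lemma tree_autI:
  assumes nil: "g [] = []" and child: "\<And>t x. \<exists>y. g (t @ [x]) = g t @ [y]" and inj: "inj g"
  shows "tree_aut g"
proof -
  have len: "length (g t) = length t" for t
  proof (induction t rule: rev_induct)
    case (snoc x t)
    then show ?case using child[of t x] by auto
  qed (simp add: nil)
  have "t \<in> range g" for t
  proof -
    let ?L = "{s :: bool list. set s \<subseteq> UNIV \<and> length s = length t}"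
    have fin: "finite ?L" by (rule finite_lists_length_eq) simp
    have "g ` ?L = ?L"
      by (rule endo_inj_surj[OF fin]) (auto simp: len inj_on_subset[OF inj])
    moreover have "t \<in> ?L" by simp
    ultimately show ?thesis by blast
  qed
  then have "bij g" using inj by (auto simp: bij_def)
  moreover have "tree_child s t \<longleftrightarrow> tree_child (g s) (g t)" for s t
  proof
    assume "tree_child s t"
    then show "tree_child (g s) (g t)" using child by (auto simp: tree_child_def)
  next
    assume "tree_child (g s) (g t)"
    then obtain y where y: "g t = g s @ [y]" by (auto simp: tree_child_def)
    then have "t \<noteq> []" using nil by auto
    then obtain t' x where t: "t = t' @ [x]" by (meson rev_exhaust)
    then have "g t' = g s" using child[of t' x] y by auto
    then show "tree_child s t" using inj t by (auto simp: tree_child_def inj_def)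
  qed
  ultimately show ?thesis using nil by (simp add: tree_aut_def)
qed

lemma tree_pair_Cons: "tree_pair u v (x # t) = x # (if x then v t else u t)"
  by (cases x) auto

lemma tree_aut_pair:
  assumes u: "tree_aut u" and v: "tree_aut v" shows "tree_aut (tree_pair u v)"
proof (rule tree_autI)
  have 0: "u [] = []" "v [] = []" using assms by (auto simp: tree_aut_def)
  show "\<exists>y. tree_pair u v (t @ [x]) = tree_pair u v t @ [y]" for t x
    using tree_aut_child[OF u] tree_aut_child[OF v] 0 by (cases t) (auto simp: tree_pair_Cons)
  have uv: "inj u" "inj v" using assms by (simp_all add: tree_aut_def bij_is_inj)
  show "inj (tree_pair u v)"
  proof (rule injI)
    fix s t assume "tree_pair u v s = tree_pair u v t"
    then show "s = t"
      by (cases s; cases t) (simp_all add: tree_pair_Cons inj_eq[OF uv(1)] inj_eq[OF uv(2)] split: if_splits)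
  qed
qed simp

lemma tree_aut_swap: "tree_aut tree_swap"
proof (rule tree_autI)
  show "\<exists>y. tree_swap (t @ [x]) = tree_swap t @ [y]" for t x
    by (cases t) auto
  show "inj tree_swap"
  proof (rule injI)
    fix s t assume "tree_swap s = tree_swap t"
    then show "s = t" by (cases s; cases t) simp_all
  qed
qed simp

definition agree_upto :: "nat \<Rightarrow> (bool list \<Rightarrow> bool list) \<Rightarrow> (bool list \<Rightarrow> bool list) \<Rightarrow> bool" where
  "agree_upto n u v \<longleftrightarrow> (\<forall>t. length t \<le> n \<longrightarrow> u t = v t)"

lemma agree_upto_refl [simp]: "agree_upto n u u"
  by (simp add: agree_upto_def)

lemma agree_upto_pair:
  "agree_upto n u u' \<Longrightarrow> agree_upto n v v' \<Longrightarrow>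
   agree_upto (Suc n) (tree_pair u v) (tree_pair u' v')"
  unfolding agree_upto_def
proof (intro allI impI)
  fix t :: "bool list"
  assume "\<forall>t. length t \<le> n \<longrightarrow> u t = u' t" "\<forall>t. length t \<le> n \<longrightarrow> v t = v' t"
    and "length t \<le> Suc n"
  then show "tree_pair u v t = tree_pair u' v' t"
    by (cases t) (auto simp: tree_pair_Cons)
qed

lemma agree_upto_comp:
  "agree_upto n u u' \<Longrightarrow> agree_upto n v v' \<Longrightarrow> tree_aut v \<Longrightarrow>
   agree_upto n (u \<circ> v) (u' \<circ> v')"
  unfolding agree_upto_def comp_apply
proof (intro allI impI)
  fix t :: "bool list"
  assume u: "\<forall>t. length t \<le> n \<longrightarrow> u t = u' t" and v: "\<forall>t. length t \<le> n \<longrightarrow> v t = v' t"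
    and a: "tree_aut v" and t: "length t \<le> n"
  have "length (v t) \<le> n" using tree_aut_length[OF a] t by simp
  then have "u (v t) = u' (v t)" using u by blast
  moreover have "v t = v' t" using v t by blast
  ultimately show "u (v t) = u' (v' t)" by metis
qed

lemma agree_upto_inv:
  assumes "agree_upto n u u'" "tree_aut u" "tree_aut u'"
  shows "agree_upto n (inv\<^bsub>AutT\<^esub> u) (inv\<^bsub>AutT\<^esub> u')"
  unfolding agree_upto_def inv_AutT[OF assms(2)] inv_AutT[OF assms(3)]
proof (intro allI impI)
  fix t :: "bool list" assume t: "length t \<le> n"
  let ?s = "Hilbert_Choice.inv u t"
  have "length ?s \<le> n" using t tree_aut_length[OF tree_aut_inv[OF assms(2)]] by simp
  moreover have "u ?s = t" using assms(2) by (simp add: tree_aut_def bij_is_surj surj_f_inv_f)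
  ultimately have "u' ?s = t" using assms(1) by (simp add: agree_upto_def)
  then show "?s = Hilbert_Choice.inv u' t"
    using assms(3) by (metis bij_inv_eq_iff tree_aut_def)
qed

lemma tree_aut_inv_AutT: "tree_aut u \<Longrightarrow> tree_aut (inv\<^bsub>AutT\<^esub> u)"
  by (simp add: inv_AutT tree_aut_inv)

text \<open>The generator families \<open>(a\<^sub>i)\<close> and \<open>(b\<^sub>j)\<close> are combined in one family indexed by
  \<open>nat + nat\<close>; the recursion is then a fixed point equation for a contracting operator.\<close>

fun recursion_step ::
    "nat \<Rightarrow> (nat + nat \<Rightarrow> bool list \<Rightarrow> bool list) \<Rightarrow> nat + nat \<Rightarrow> bool list \<Rightarrow> bool list" where
  "recursion_step r c (Inl i) =
     (if i = 1 then tree_swap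
      else if i = r + 1 then tree_pair (c (Inl r)) (c (Inr r))
      else tree_pair (c (Inl (i - 1))) id)"
| "recursion_step r c (Inr j) =
     (if j = 1 then tree_pair (c (Inr r)) (inv\<^bsub>AutT\<^esub> (c (Inr r))) \<circ> tree_swap
      else tree_pair (c (Inr r) \<circ> c (Inr (j - 1)) \<circ> inv\<^bsub>AutT\<^esub> (c (Inr r))) id)"

definition indices :: "nat \<Rightarrow> (nat + nat) set" where
  "indices r = Inl ` {1..} \<union> Inr ` {1..r}"

lemma recursion_step_aut:
  assumes "\<And>x. tree_aut (c x)" shows "tree_aut (recursion_step r c x)"
  using assms by (cases x)
    (simp_all add: tree_aut_pair tree_aut_comp tree_aut_swap tree_aut_inv_AutT)

lemma recursion_step_contract:
  assumes r: "1 \<le> r"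
    and c: "\<And>x. x \<in> indices r \<Longrightarrow> tree_aut (c x)"
    and d: "\<And>x. x \<in> indices r \<Longrightarrow> tree_aut (d x)"
    and cd: "\<And>x. x \<in> indices r \<Longrightarrow> agree_upto n (c x) (d x)"
    and x: "x \<in> indices r"
  shows "agree_upto (Suc n) (recursion_step r c x) (recursion_step r d x)"
proof -
  have I: "Inl i \<in> indices r \<longleftrightarrow> 1 \<le> i" "Inr i \<in> indices r \<longleftrightarrow> 1 \<le> i \<and> i \<le> r" for i
    by (auto simp: indices_def)
  have rr: "Inl r \<in> indices r" "Inr r \<in> indices r" using r I by auto
  show ?thesis
  proof (cases x)
    case (Inl i)
    consider "i = 1" | "i = r + 1" "i \<noteq> 1" | "i \<noteq> 1" "i \<noteq> r + 1" by blast
    then show ?thesis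
    proof cases
      case 1
      then show ?thesis using Inl by simp
    next
      case 2
      then show ?thesis using Inl agree_upto_pair[OF cd[OF rr(1)] cd[OF rr(2)]] by simp
    next
      case 3
      then have "Inl (i - 1) \<in> indices r" using x unfolding Inl I by linarith
      then show ?thesis using Inl 3 agree_upto_pair[OF cd agree_upto_refl] by simp
    qed
  next
    case (Inr j)
    note inv = agree_upto_inv[OF cd[OF rr(2)] c[OF rr(2)] d[OF rr(2)]]
    show ?thesis
    proof (cases "j = 1")
      case True
      then show ?thesis
        using Inr agree_upto_comp[OF agree_upto_pair[OF cd[OF rr(2)] inv] agree_upto_refl tree_aut_swap]
        by simp
    next
      case False
      have J: "Inr (j - 1) \<in> indices r"
        using x Inr False unfolding Inr I by linarith
      show ?thesis
        using Inr False
          agree_upto_pair[OF agree_upto_comp[OF agree_upto_comp[OF cd[OF rr(2)] cd[OF J] c[OF J]]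
            inv tree_aut_inv_AutT[OF c[OF rr(2)]]] agree_upto_refl]
        by simp
    qed
  qed
qed

lemma generator_recursion_iff_fixpoint:
  assumes "1 \<le> r"
  shows "generator_recursion r a b \<longleftrightarrow>
    (\<forall>x\<in>indices r. tree_aut (case_sum a b x) \<and>
       recursion_step r (case_sum a b) x = case_sum a b x)"
proof -
  let ?c = "case_sum a b"
  have ball: "(\<forall>x\<in>indices r. P x) \<longleftrightarrow> (\<forall>i\<ge>1. P (Inl i)) \<and> (\<forall>j\<in>{1..r}. P (Inr j))" for P
    by (auto simp: indices_def)
  have A: "(\<forall>i\<ge>1. recursion_step r ?c (Inl i) = a i) \<longleftrightarrow>
      a 1 = tree_swap \<and> a (r + 1) = tree_pair (a r) (b r) \<and>
      (\<forall>i>1. i \<noteq> r + 1 \<longrightarrow> a i = tree_pair (a (i - 1)) id)" (is "?L \<longleftrightarrow> ?R")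
  proof
    assume L: ?L
    have "a 1 = tree_swap" using L[rule_format, of 1] by simp
    moreover have "a (r + 1) = tree_pair (a r) (b r)"
      using L[rule_format, of "r + 1"] assms by simp
    moreover have "a i = tree_pair (a (i - 1)) id" if "i > 1" "i \<noteq> r + 1" for i
      using L[rule_format, of i] that by simp
    ultimately show ?R by blast
  next
    assume R: ?R
    show ?L
    proof (intro allI impI)
      fix i :: nat assume "1 \<le> i"
      then consider "i = 1" | "i = r + 1" "i \<noteq> 1" | "i > 1" "i \<noteq> r + 1" by linarith
      then show "recursion_step r ?c (Inl i) = a i"
      proof cases
        case 1
        then show ?thesis using R by simp
      next
        case 2
        then have "recursion_step r ?c (Inl i) = tree_pair (a r) (b r)" by simp
        then show ?thesis using R 2 by metis
      next
        case 3
        then have "recursion_step r ?c (Inl i) = tree_pair (a (i - 1)) id" by simp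
        then show ?thesis using R 3 by metis
      qed
    qed
  qed
  have B: "(\<forall>j\<in>{1..r}. recursion_step r ?c (Inr j) = b j) \<longleftrightarrow>
      b 1 = tree_pair (b r) (inv\<^bsub>AutT\<^esub> (b r)) \<circ> tree_swap \<and>
      (\<forall>j. 1 < j \<and> j \<le> r \<longrightarrow>
         b j = tree_pair (b r \<circ> b (j - 1) \<circ> inv\<^bsub>AutT\<^esub> (b r)) id)" (is "?L \<longleftrightarrow> ?R")
  proof
    assume L: ?L
    have "b 1 = tree_pair (b r) (inv\<^bsub>AutT\<^esub> (b r)) \<circ> tree_swap"
    proof -
      have "recursion_step r ?c (Inr 1) = b 1" using bspec[OF L, of 1] assms by auto
      moreover have "recursion_step r ?c (Inr 1) =
          tree_pair (b r) (inv\<^bsub>AutT\<^esub> (b r)) \<circ> tree_swap"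
        by simp
      ultimately show ?thesis by metis
    qed
    moreover have "b j = tree_pair (b r \<circ> b (j - 1) \<circ> inv\<^bsub>AutT\<^esub> (b r)) id"
      if "1 < j" "j \<le> r" for j
    proof -
      have "recursion_step r ?c (Inr j) = b j" using bspec[OF L, of j] that by auto
      then show ?thesis using that(1) by auto
    qed
    ultimately show ?R by blast
  next
    assume R: ?R
    show ?L
    proof
      fix j assume "j \<in> {1..r}"
      then consider "j = 1" | "1 < j" "j \<le> r" unfolding atLeastAtMost_iff by linarith
      then show "recursion_step r ?c (Inr j) = b j"
      proof cases
        case 1
        then have "recursion_step r ?c (Inr j) =
            tree_pair (b r) (inv\<^bsub>AutT\<^esub> (b r)) \<circ> tree_swap"
          by simp
        then show ?thesis using R 1 by metis
      next
        case 2
        then have "recursion_step r ?c (Inr j) =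
            tree_pair (b r \<circ> b (j - 1) \<circ> inv\<^bsub>AutT\<^esub> (b r)) id"
          by simp
        then show ?thesis using R 2 by metis
      qed
    qed
  qed
  have "(\<forall>x\<in>indices r. tree_aut (?c x) \<and> recursion_step r ?c x = ?c x) \<longleftrightarrow>
      (\<forall>i\<ge>1. tree_aut (a i)) \<and> (\<forall>j\<in>{1..r}. tree_aut (b j)) \<and>
      (\<forall>i\<ge>1. recursion_step r ?c (Inl i) = a i) \<and>
      (\<forall>j\<in>{1..r}. recursion_step r ?c (Inr j) = b j)"
    unfolding ball sum.case by blast
  then show ?thesis
    unfolding generator_recursion_def A B AutT_simps mem_Collect_eq by blast
qed

lemma fixpoint_unique:
  assumes r: "1 \<le> r"
    and c: "\<And>x. x \<in> indices r \<Longrightarrow> tree_aut (c x)"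
      "\<And>x. x \<in> indices r \<Longrightarrow> recursion_step r c x = c x"
    and d: "\<And>x. x \<in> indices r \<Longrightarrow> tree_aut (d x)"
      "\<And>x. x \<in> indices r \<Longrightarrow> recursion_step r d x = d x"
    and x: "x \<in> indices r"
  shows "c x = d x"
proof -
  have "agree_upto n (c x) (d x)" if "x \<in> indices r" for n x
    using that
  proof (induction n arbitrary: x)
    case (0 x)
    have "c x [] = []" "d x [] = []"
      using c(1)[OF 0] d(1)[OF 0] by (simp_all add: tree_aut_def)
    then show ?case by (simp add: agree_upto_def)
  next
    case (Suc n x)
    have "agree_upto (Suc n) (recursion_step r c x) (recursion_step r d x)"
      by (rule recursion_step_contract[OF r c(1) d(1) Suc.IH Suc.prems])
    then show ?case
      using c(2)[OF Suc.prems] d(2)[OF Suc.prems] by simp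
  qed
  then show ?thesis using x unfolding agree_upto_def by blast
qed

lemma generator_recursion_unique:
  assumes r: "1 \<le> r" and ab: "generator_recursion r a b" "generator_recursion r a' b'"
  shows "(\<forall>i\<ge>1. a i = a' i) \<and> (\<forall>j\<in>{1..r}. b j = b' j)"
proof -
  define c d where "c = case_sum a b" and "d = case_sum a' b'"
  have "\<forall>x\<in>indices r. tree_aut (c x) \<and> recursion_step r c x = c x"
      "\<forall>x\<in>indices r. tree_aut (d x) \<and> recursion_step r d x = d x"
    using ab unfolding generator_recursion_iff_fixpoint[OF r] c_def d_def .
  then have eq: "c x = d x" if "x \<in> indices r" for x
    using fixpoint_unique[of r c d x] r that by blast
  have "a i = a' i" if "1 \<le> i" for i
    using eq[of "Inl i"] that by (simp add: indices_def c_def d_def)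
  moreover have "b j = b' j" if "j \<in> {1..r}" for j
    using eq[of "Inr j"] that by (simp add: indices_def c_def d_def)
  ultimately show ?thesis by blast
qed

lemma generator_recursion_exists:
  assumes r: "1 \<le> r"
  shows "\<exists>a b. generator_recursion r a b"
proof -
  define c where "c n = (recursion_step r ^^ n) (\<lambda>_. id)" for n
  have cS: "c (Suc n) = recursion_step r (c n)" for n
    by (simp add: c_def)
  have aut: "tree_aut (c n x)" for n x
  proof (induction n arbitrary: x)
    case (Suc n)
    then show ?case by (simp add: cS recursion_step_aut)
  qed (simp add: c_def)
  have approx: "\<forall>x\<in>indices r. agree_upto n (c n x) (c (Suc n) x)" for n
  proof (induction n)
    case 0
    show ?case using aut by (auto simp: agree_upto_def tree_aut_def)
  next
    case (Suc n)
    show ?case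
    proof
      fix x assume x: "x \<in> indices r"
      show "agree_upto (Suc n) (c (Suc n) x) (c (Suc (Suc n)) x)"
        using recursion_step_contract[where c = "c n" and d = "c (Suc n)", OF r aut aut bspec[OF Suc] x]
        unfolding cS[symmetric] .
    qed
  qed
  have agree: "agree_upto n (c n x) (c m x)" if "n \<le> m" "x \<in> indices r" for n m x
    using that(1)
  proof (induction m rule: dec_induct)
    case (step m)
    then show ?case using approx[of m] that(2) by (simp add: agree_upto_def)
  qed simp
  define e where "e x t = c (length t) x t" for x t
  have ec: "e x t = c n x t" if "length t \<le> n" "x \<in> indices r" for x t n
    using agree[OF that] by (simp add: agree_upto_def e_def)
  have eaut: "tree_aut (e x)" if x: "x \<in> indices r" for x
  proof (rule tree_autI)
    show "e x [] = []" using aut by (simp add: e_def tree_aut_def)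
    show "\<exists>y. e x (t @ [z]) = e x t @ [y]" for t z
      using ec[of t "Suc (length t)" x] x tree_aut_child[OF aut, of "Suc (length t)" x t z]
      by (simp add: e_def)
    show "inj (e x)"
    proof (rule injI)
      fix s t assume "e x s = e x t"
      then have "c (max (length s) (length t)) x s = c (max (length s) (length t)) x t"
        using ec[of _ "max (length s) (length t)"] x by simp
      then show "s = t" using aut by (meson bij_is_inj injD tree_aut_def)
    qed
  qed
  have fix_e: "recursion_step r e x = e x" if x: "x \<in> indices r" for x
  proof
    fix t :: "bool list"
    let ?n = "length t"
    have "agree_upto (Suc ?n) (recursion_step r e x) (recursion_step r (c ?n) x)"
      by (rule recursion_step_contract[OF r eaut aut _ x]) (simp_all add: agree_upto_def ec)
    then have "recursion_step r e x t = c (Suc ?n) x t"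
      by (simp add: agree_upto_def cS)
    then show "recursion_step r e x t = e x t"
      using ec[of t "Suc ?n" x] x by simp
  qed
  have "case_sum (\<lambda>i. e (Inl i)) (\<lambda>j. e (Inr j)) = e"
    by (auto split: sum.split)
  then have "generator_recursion r (\<lambda>i. e (Inl i)) (\<lambda>j. e (Inr j))"
    unfolding generator_recursion_iff_fixpoint[OF r] using eaut fix_e by simp
  then show ?thesis by blast
qed

end

theory Submission
  imports Defs "HOL-Algebra.Zassenhaus"
begin

text \<open>Let \<open>\<chi>(g)(t)\<close> be the parity of the permutation induced by the section of \<open>g\<close> at the vertex
  \<open>t\<close> on level \<open>r + 1\<close>. Then \<open>\<chi>(g h)(t) = \<chi>(g)(h t) + \<chi>(h)(t)\<close>, and \<open>G(r)\<close> turns out to be exactly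
  the kernel \<open>\<chi> = 0\<close>: a pair \<open>(x, y)\<close> of elements of \<open>G(r)\<close> lies in \<open>G(r)\<close> iff \<open>x\<close> and \<open>y\<close> have the
  same parity on level \<open>r\<close>. By the cocycle identity, \<open>g\<close> normalizes \<open>G(r)\<close> iff \<open>\<chi>(g)\<close> is
  \<open>G(r)\<close>-invariant, which by level transitivity means that \<open>\<chi>(g)(t)\<close> depends only on the length
  of \<open>t\<close>. So \<open>\<chi>\<close> embeds \<open>N(r)/G(r)\<close> into \<open>\<Prod>\<^sub>i \<F>\<^sub>2\<close>, and since \<open>\<chi>(w\<^sub>i)(t) = 1\<close> iff
  \<open>t\<close> has length \<open>i - 1\<close>, it inverts the map induced by \<open>\<phi>\<close>.\<close>

section \<open>Sections and level parities\<close>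

definition root_flip :: "(bool list \<Rightarrow> bool list) \<Rightarrow> bool" where
  "root_flip g \<longleftrightarrow> g [False] = [True]"

text \<open>Dropping the first letter loses nothing: for an automorphism it is \<open>x\<close>,
  flipped or not according to \<open>root_flip g\<close>, whatever \<open>t\<close> is.\<close>

definition tree_section :: "(bool list \<Rightarrow> bool list) \<Rightarrow> bool \<Rightarrow> bool list \<Rightarrow> bool list" where
  "tree_section g x t = tl (g (x # t))"

lemma tree_aut_prefix:
  assumes "tree_aut g" shows "take (length s) (g (s @ t)) = g s"
proof (induction t rule: rev_induct)
  case Nil
  then show ?case by (simp add: tree_aut_length[OF assms])
next
  case (snoc x t)
  obtain y where "g ((s @ t) @ [x]) = g (s @ t) @ [y]"
    using tree_aut_child[OF assms] by blast
  with snoc show ?case by (simp add: tree_aut_length[OF assms])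
qed

lemma tree_aut_Nil [simp]: "tree_aut g \<Longrightarrow> g [] = []"
  by (simp add: tree_aut_def)

lemma tree_aut_inj: "tree_aut g \<Longrightarrow> g s = g t \<longleftrightarrow> s = t"
  by (simp add: tree_aut_def bij_is_inj inj_eq)

lemma tree_aut_singleton:
  assumes "tree_aut g" shows "g [x] = [x \<noteq> root_flip g]"
proof -
  obtain y z where yz: "g [False] = [y]" "g [True] = [z]"
    using tree_aut_child[OF assms, of "[]"] assms by (metis append_Nil tree_aut_Nil)
  then have "y \<noteq> z" using tree_aut_inj[OF assms, of "[False]" "[True]"] by simp
  with yz show ?thesis by (cases x) (auto simp: root_flip_def)
qed

lemma tree_aut_Cons:
  assumes "tree_aut g" shows "g (x # t) = (x \<noteq> root_flip g) # tree_section g x t"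
proof -
  have "take 1 (g (x # t)) = [x \<noteq> root_flip g]"
    using tree_aut_prefix[OF assms, of "[x]" t] tree_aut_singleton[OF assms] by simp
  moreover have "length (g (x # t)) = Suc (length t)"
    by (simp add: tree_aut_length[OF assms])
  ultimately show ?thesis
    unfolding tree_section_def by (cases "g (x # t)") auto
qed

lemma tree_aut_section:
  assumes g: "tree_aut g" shows "tree_aut (tree_section g x)"
proof (rule tree_autI)
  show "tree_section g x [] = []"
    using tree_aut_Cons[OF g, of x "[]"] tree_aut_singleton[OF g, of x] by simp
  show "\<exists>y. tree_section g x (t @ [z]) = tree_section g x t @ [y]" for t z
    using tree_aut_child[OF g, of "x # t" z]
    by (simp add: tree_aut_Cons[OF g])
  show "inj (tree_section g x)"
  proof (rule injI)
    fix s t assume "tree_section g x s = tree_section g x t"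
    then have "g (x # s) = g (x # t)" by (simp add: tree_aut_Cons[OF g])
    then show "s = t" by (simp add: tree_aut_inj[OF g])
  qed
qed

lemma root_flip_comp:
  "tree_aut g \<Longrightarrow> tree_aut h \<Longrightarrow> root_flip (g \<circ> h) \<longleftrightarrow> root_flip g \<noteq> root_flip h"
  using tree_aut_singleton[of h False] tree_aut_singleton[of g "root_flip h"]
  unfolding root_flip_def[of "g \<circ> h"] comp_apply by (cases "root_flip h") simp_all

text \<open>\<open>h\<close> acts first and may exchange the subtrees, so the section of
  \<open>g\<close> is taken at the vertex to which \<open>h\<close> moves
  \<open>[x]\<close>.\<close>

lemma tree_section_comp:
  "tree_aut g \<Longrightarrow> tree_aut h \<Longrightarrow>
   tree_section (g \<circ> h) x = tree_section g (x \<noteq> root_flip h) \<circ> tree_section h x"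
  by (rule ext) (simp add: tree_section_def[of "g \<circ> h"] tree_aut_Cons)

lemma root_flip_simps [simp]:
  "\<not> root_flip id" "root_flip tree_swap" "u [] = [] \<Longrightarrow> \<not> root_flip (tree_pair u v)"
  by (simp_all add: root_flip_def)

lemma tree_section_simps [simp]:
  "tree_section id x = id" "tree_section tree_swap x = id"
  "tree_section (tree_pair u v) x = (if x then v else u)"
  unfolding fun_eq_iff by (auto simp: tree_section_def tree_pair_Cons)

lemma tree_aut_decompose:
  assumes "tree_aut g"
  shows "g = (if root_flip g
    then tree_pair (tree_section g True) (tree_section g False) \<circ> tree_swap
    else tree_pair (tree_section g False) (tree_section g True))"
proof
  fix t
  show "g t = (if root_flip g
    then tree_pair (tree_section g True) (tree_section g False) \<circ> tree_swap
    else tree_pair (tree_section g False) (tree_section g True)) t"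
    using assms by (cases t) (auto simp: tree_aut_Cons tree_pair_Cons)
qed

lemma tree_pair_comp: "tree_pair u v \<circ> tree_pair u' v' = tree_pair (u \<circ> u') (v \<circ> v')"
proof
  fix t show "(tree_pair u v \<circ> tree_pair u' v') t = tree_pair (u \<circ> u') (v \<circ> v') t"
    by (cases t) (auto simp: tree_pair_Cons)
qed

lemma tree_pair_id [simp]: "tree_pair id id = id"
proof
  fix t show "tree_pair id id t = id t" by (cases t) (auto simp: tree_pair_Cons)
qed

lemma tree_swap_swap [simp]: "tree_swap \<circ> tree_swap = id"
proof
  fix t show "(tree_swap \<circ> tree_swap) t = id t" by (cases t) auto
qed

lemma tree_swap_pair: "tree_swap \<circ> tree_pair u v = tree_pair v u \<circ> tree_swap"
proof
  fix t show "(tree_swap \<circ> tree_pair u v) t = (tree_pair v u \<circ> tree_swap) t"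
    by (cases t) (auto simp: tree_pair_Cons)
qed

text \<open>\<open>level_parity n g\<close> holds iff the permutation that \<open>g\<close> induces on level \<open>n + 1\<close> is odd.\<close>

fun level_parity :: "nat \<Rightarrow> (bool list \<Rightarrow> bool list) \<Rightarrow> bool" where
  "level_parity 0 g \<longleftrightarrow> root_flip g"
| "level_parity (Suc n) g \<longleftrightarrow>
     level_parity n (tree_section g False) \<noteq> level_parity n (tree_section g True)"

text \<open>For \<open>n = r\<close> this is the cocycle \<chi>(g)(t); the section at
  \<open>t\<close> is reached one letter at a time.\<close>

fun parity_at :: "nat \<Rightarrow> (bool list \<Rightarrow> bool list) \<Rightarrow> bool list \<Rightarrow> bool" where
  "parity_at n g [] \<longleftrightarrow> level_parity n g"
| "parity_at n g (x # t) \<longleftrightarrow> parity_at n (tree_section g x) t"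

lemma level_parity_id [simp]: "\<not> level_parity n id"
  by (induction n) (simp_all del: id_apply)

lemma parity_at_id [simp]: "\<not> parity_at n id t"
  by (induction t) (simp_all del: id_apply)

lemma level_parity_comp:
  "tree_aut g \<Longrightarrow> tree_aut h \<Longrightarrow>
   level_parity n (g \<circ> h) \<longleftrightarrow> level_parity n g \<noteq> level_parity n h"
proof (induction n arbitrary: g h)
  case 0
  then show ?case by (simp add: root_flip_comp del: o_apply)
next
  case (Suc n)
  note IH = Suc.IH[OF tree_aut_section tree_aut_section, OF Suc.prems]
  \<comment> \<open>A root flip of \<open>h\<close> only exchanges the sections of \<open>g\<close>,
    and exclusive or is symmetric.\<close>
  show ?case
    using Suc.prems by (cases "root_flip h") (auto simp: tree_section_comp IH simp del: o_apply)
qed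

text \<open>The section of \<open>g \<circ> h\<close> at \<open>t\<close> is that of
  \<open>g\<close> at \<open>h t\<close> composed with that of \<open>h\<close> at \<open>t\<close>,
  and level parities add up.\<close>

lemma parity_at_comp:
  "tree_aut g \<Longrightarrow> tree_aut h \<Longrightarrow>
   parity_at n (g \<circ> h) t \<longleftrightarrow> parity_at n g (h t) \<noteq> parity_at n h t"
  by (induction t arbitrary: g h)
    (simp_all add: level_parity_comp tree_section_comp tree_aut_section tree_aut_Cons del: o_apply)

lemma inv_AutT_comp:
  "tree_aut g \<Longrightarrow> g \<circ> inv\<^bsub>AutT\<^esub> g = id" "tree_aut g \<Longrightarrow> inv\<^bsub>AutT\<^esub> g \<circ> g = id"
  using group.r_inv[OF group_AutT, of g] group.l_inv[OF group_AutT, of g] by simp_all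

lemma parity_at_inv:
  assumes "tree_aut g"
  shows "parity_at n (inv\<^bsub>AutT\<^esub> g) t \<longleftrightarrow> parity_at n g ((inv\<^bsub>AutT\<^esub> g) t)"
  using parity_at_comp[OF assms tree_aut_inv_AutT[OF assms], of n t] inv_AutT_comp(1)[OF assms]
  by simp

section \<open>Parities depend on finite depth only\<close>

lemma agree_upto_section:
  "agree_upto (Suc n) g h \<Longrightarrow> agree_upto n (tree_section g x) (tree_section h x)"
  by (simp add: agree_upto_def tree_section_def)

lemma agree_upto_mono: "agree_upto n g h \<Longrightarrow> m \<le> n \<Longrightarrow> agree_upto m g h"
  by (simp add: agree_upto_def)

lemma level_parity_agree:
  "agree_upto (Suc n) g h \<Longrightarrow> level_parity n g \<longleftrightarrow> level_parity n h"
proof (induction n arbitrary: g h)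
  case 0
  then show ?case by (simp add: agree_upto_def root_flip_def)
next
  case (Suc n)
  then show ?case
    unfolding level_parity.simps by (metis agree_upto_section)
qed

lemma parity_at_agree:
  "agree_upto (Suc (length t + n)) g h \<Longrightarrow> parity_at n g t \<longleftrightarrow> parity_at n h t"
proof (induction t arbitrary: g h)
  case Nil
  then show ?case by (simp add: level_parity_agree)
next
  case (Cons x t)
  then show ?case using agree_upto_section[of "Suc (length t + n)" g h x] by simp
qed

section \<open>The topology\<close>

lemma topspace_AutT_topology: "topspace AutT_topology = {g. tree_aut g}"
  by (simp add: AutT_topology_def)

lemma openin_AutT_cylinder:
  assumes "openin AutT_topology U" "g \<in> U"
  obtains n where "\<And>h. tree_aut h \<Longrightarrow> agree_upto n g h \<Longrightarrow> h \<in> U"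
proof -
  obtain V where V: "openin (product_topology (\<lambda>_::bool list. discrete_topology (UNIV :: bool list set)) UNIV) V"
    "U = V \<inter> {g. tree_aut g}"
    using assms(1) by (auto simp: AutT_topology_def openin_subtopology)
  then obtain W where W: "finite {t. W t \<noteq> UNIV}" "g \<in> Pi\<^sub>E UNIV W" "Pi\<^sub>E UNIV W \<subseteq> V"
    using assms(2) unfolding openin_product_topology_alt by fastforce
  \<comment> \<open>The depth of the deepest constrained vertex; \<open>0\<close> covers the case of
    no constraint.\<close>
  define n where "n = Max (insert 0 (length ` {t. W t \<noteq> UNIV}))"
  have len: "length t \<le> n" if "W t \<noteq> UNIV" for t
    unfolding n_def using W(1) that by (intro Max_ge) auto
  have "h \<in> U" if "tree_aut h" "agree_upto n g h" for h
  proof -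
    have "h t \<in> W t" for t
    proof (cases "W t = UNIV")
      case False
      then have "g t = h t" using len that(2) by (simp add: agree_upto_def)
      then show ?thesis using W(2) by (metis PiE_mem UNIV_I)
    qed simp
    then show ?thesis using W(3) V(2) that(1) by auto
  qed
  then show ?thesis using that by blast
qed

lemma openin_AutT_vertex: "openin AutT_topology {h. tree_aut h \<and> h t = s}"
proof -
  let ?X = "product_topology (\<lambda>_::bool list. discrete_topology (UNIV :: bool list set)) UNIV"
  have "openin ?X {h \<in> topspace ?X. h t \<in> {s}}"
    by (rule openin_continuous_map_preimage[OF continuous_map_product_projection]) simp_all
  moreover have "{h. tree_aut h \<and> h t = s} = {h \<in> topspace ?X. h t \<in> {s}} \<inter> {h. tree_aut h}"
    by auto
  ultimately show ?thesis
    unfolding AutT_topology_def openin_subtopology AutT_simps by blast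
qed

lemma openin_AutT_agree: "openin AutT_topology {h. tree_aut h \<and> agree_upto n g h}"
proof -
  let ?L = "{t :: bool list. length t \<le> n}"
  have "finite ?L"
    using finite_lists_length_le[of "UNIV :: bool set" n] by simp
  then have "openin AutT_topology (\<Inter>t\<in>?L. {h. tree_aut h \<and> h t = g t})"
    by (intro openin_INT2) (auto simp: openin_AutT_vertex intro!: exI[of _ "[]"])
  moreover have "(\<Inter>t\<in>?L. {h. tree_aut h \<and> h t = g t}) = {h. tree_aut h \<and> agree_upto n g h}"
  proof (rule Set.set_eqI, rule iffI)
    fix h assume h: "h \<in> (\<Inter>t\<in>?L. {h. tree_aut h \<and> h t = g t})"
    then have "tree_aut h" using INT_D[OF h, of "[]"] by simp
    then show "h \<in> {h. tree_aut h \<and> agree_upto n g h}"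
      using h by (simp add: agree_upto_def)
  qed (simp add: agree_upto_def)
  ultimately show ?thesis by simp
qed

lemma in_closure_AutT:
  assumes "S \<subseteq> carrier AutT"
  shows "g \<in> AutT_topology closure_of S \<longleftrightarrow> tree_aut g \<and> (\<forall>n. \<exists>h\<in>S. agree_upto n g h)"
proof
  assume g: "g \<in> AutT_topology closure_of S"
  then have "tree_aut g" by (simp add: in_closure_of topspace_AutT_topology)
  moreover have "\<exists>h\<in>S. agree_upto n g h" for n
  proof -
    have "g \<in> {h. tree_aut h \<and> agree_upto n g h}" using \<open>tree_aut g\<close> by simp
    then obtain y where "y \<in> S" "y \<in> {h. tree_aut h \<and> agree_upto n g h}"
      using g[unfolded in_closure_of] openin_AutT_agree[of n g] by metis
    then show ?thesis by blast
  qed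
  ultimately show "tree_aut g \<and> (\<forall>n. \<exists>h\<in>S. agree_upto n g h)" by blast
next
  assume g: "tree_aut g \<and> (\<forall>n. \<exists>h\<in>S. agree_upto n g h)"
  have "\<exists>y. y \<in> S \<and> y \<in> U" if U: "openin AutT_topology U" "g \<in> U" for U
  proof -
    obtain n where "\<And>h. tree_aut h \<Longrightarrow> agree_upto n g h \<Longrightarrow> h \<in> U"
      using openin_AutT_cylinder[OF U] by blast
    moreover obtain h where "h \<in> S" "agree_upto n g h" using g by blast
    ultimately show ?thesis using assms by auto
  qed
  then show "g \<in> AutT_topology closure_of S"
    using g by (simp add: in_closure_of topspace_AutT_topology)
qed

lemma limitin_AutT:
  "limitin AutT_topology f g sequentially \<longleftrightarrow>
     tree_aut g \<and> (\<forall>n. \<forall>\<^sub>F m in sequentially. tree_aut (f m) \<and> agree_upto n g (f m))"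
proof
  assume L: "limitin AutT_topology f g sequentially"
  then have g: "tree_aut g" by (simp add: limitin_def topspace_AutT_topology)
  have "\<forall>\<^sub>F m in sequentially. f m \<in> {h. tree_aut h \<and> agree_upto n g h}" for n
  proof -
    have "g \<in> {h. tree_aut h \<and> agree_upto n g h}" using g by simp
    then show ?thesis using L openin_AutT_agree[of n g] unfolding limitin_def by blast
  qed
  then show "tree_aut g \<and> (\<forall>n. \<forall>\<^sub>F m in sequentially. tree_aut (f m) \<and> agree_upto n g (f m))"
    using g by simp
next
  assume R: "tree_aut g \<and> (\<forall>n. \<forall>\<^sub>F m in sequentially. tree_aut (f m) \<and> agree_upto n g (f m))"
  have "\<forall>\<^sub>F m in sequentially. f m \<in> U" if U: "openin AutT_topology U" "g \<in> U" for U
  proof -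
    obtain n where "\<And>h. tree_aut h \<Longrightarrow> agree_upto n g h \<Longrightarrow> h \<in> U"
      using openin_AutT_cylinder[OF U] by blast
    moreover have "\<forall>\<^sub>F m in sequentially. tree_aut (f m) \<and> agree_upto n g (f m)"
      using R by blast
    ultimately show ?thesis by (auto elim: eventually_mono)
  qed
  then show "limitin AutT_topology f g sequentially"
    using R by (simp add: limitin_def topspace_AutT_topology)
qed

lemma limitin_AutT_unique:
  assumes "limitin AutT_topology f g sequentially" "limitin AutT_topology f h sequentially"
  shows "g = h"
proof
  fix t :: "bool list"
  have "\<forall>\<^sub>F m in sequentially. agree_upto (length t) g (f m) \<and> agree_upto (length t) h (f m)"
    using assms unfolding limitin_AutT by (simp add: eventually_conj_iff)
  then obtain m where "agree_upto (length t) g (f m)" "agree_upto (length t) h (f m)"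
    using eventually_happens'[OF sequentially_bot] by blast
  then show "g t = h t" by (simp add: agree_upto_def)
qed

section \<open>The finitely constrained group of even automorphisms\<close>

definition even_group :: "nat \<Rightarrow> (bool list \<Rightarrow> bool list) set" where
  "even_group n = {g. tree_aut g \<and> (\<forall>t. \<not> parity_at n g t)}"

lemma even_group_aut: "g \<in> even_group n \<Longrightarrow> tree_aut g"
  by (simp add: even_group_def)

lemma subgroup_even_group: "subgroup (even_group n) AutT"
proof
  show "even_group n \<subseteq> carrier AutT" by (auto simp: even_group_def)
qed (auto simp: even_group_def tree_aut_comp parity_at_comp tree_aut_inv_AutT parity_at_inv)

text \<open>A parity sees only finite depth, so it is inherited from a close enough element of
  \<open>S\<close>.\<close>

lemma even_group_closed:
  assumes "S \<subseteq> even_group n" shows "AutT_topology closure_of S \<subseteq> even_group n"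
proof
  fix g assume g: "g \<in> AutT_topology closure_of S"
  have S: "S \<subseteq> carrier AutT" using assms by (auto simp: even_group_def)
  have "\<not> parity_at n g t" for t
  proof -
    obtain h where "h \<in> S" "agree_upto (Suc (length t + n)) g h"
      using g unfolding in_closure_AutT[OF S] by blast
    then show ?thesis using parity_at_agree assms by (auto simp: even_group_def)
  qed
  then show "g \<in> even_group n"
    using g unfolding in_closure_AutT[OF S] by (simp add: even_group_def)
qed

text \<open>Below the root the parities are those of \<open>u\<close> and \<open>v\<close>; at the
  root the parities of \<open>u\<close> and \<open>v\<close> one level higher must cancel.\<close>

lemma even_group_pair:
  assumes "u \<in> even_group (Suc n)" "v \<in> even_group (Suc n)"
    and "level_parity n u \<longleftrightarrow> level_parity n v"
  shows "tree_pair u v \<in> even_group (Suc n)"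
proof -
  have "\<not> parity_at (Suc n) (tree_pair u v) t" for t
    using assms by (cases t) (auto simp: even_group_def)
  then show ?thesis using assms by (simp add: even_group_def tree_aut_pair)
qed

text \<open>The swap is odd on level 1 but even on every deeper level, hence the index
  \<open>Suc n\<close>.\<close>

lemma even_group_swap: "tree_swap \<in> even_group (Suc n)"
proof -
  have "\<not> parity_at (Suc n) tree_swap t" for t by (cases t) auto
  then show ?thesis by (simp add: even_group_def tree_aut_swap)
qed

lemma even_group_section:
  assumes "g \<in> even_group n" shows "tree_section g x \<in> even_group n"
proof -
  have "\<not> parity_at n g (x # t)" for t
    using assms unfolding even_group_def by blast
  then show ?thesis using assms by (simp add: even_group_def tree_aut_section)
qed

lemma even_group_level_transitive:
  assumes "length s = length t"
  obtains g where "g \<in> even_group (Suc n)" "g s = t"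
proof -
  have "\<exists>g\<in>even_group (Suc n). g s = t"
    using assms
  proof (induction s arbitrary: t)
    case Nil
    then show ?case by (intro bexI[of _ id]) (auto simp: even_group_def)
  next
    case (Cons x s)
    then obtain y t' where t: "t = y # t'" "length s = length t'" by (cases t) auto
    then obtain g where g: "g \<in> even_group (Suc n)" "g s = t'" using Cons.IH by blast
    \<comment> \<open>Equal coordinates satisfy the parity condition of
      \<open>even_group_pair\<close>; the swap adjusts the first letter if necessary.\<close>
    let ?p = "tree_pair g g"
    have p: "?p \<in> even_group (Suc n)" using g(1) by (intro even_group_pair) auto
    have "?p \<circ> tree_swap \<in> even_group (Suc n)"
      using subgroup.m_closed[OF subgroup_even_group p even_group_swap] by simp
    then show ?case
      using p g(2) t(1) by (cases "x = y") (auto simp: tree_pair_Cons intro: rev_bexI)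
  qed
  then show ?thesis using that by blast
qed

lemma normalizer_even_group:
  "normalizer AutT (even_group (Suc n)) =
     {g. tree_aut g \<and> (\<forall>s t. length s = length t \<longrightarrow>
        parity_at (Suc n) g s = parity_at (Suc n) g t)}" (is "_ = ?L")
proof -
  let ?P = "even_group (Suc n)"
  have P: "?P \<subseteq> carrier AutT" using even_group_aut by auto
  have norm: "g \<in> normalizer AutT ?P \<longleftrightarrow>
      tree_aut g \<and> (\<lambda>p. g \<circ> p \<circ> inv\<^bsub>AutT\<^esub> g) ` ?P = ?P" for g
  proof -
    have "g <#\<^bsub>AutT\<^esub> ?P #>\<^bsub>AutT\<^esub> inv\<^bsub>AutT\<^esub> g = (\<lambda>p. g \<circ> p \<circ> inv\<^bsub>AutT\<^esub> g) ` ?P"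
      by (auto simp: l_coset_def r_coset_def)
    then show ?thesis using P by (simp add: normalizer_def stabilizer_def)
  qed
  \<comment> \<open>Evaluate the cocycle on both sides of
    \<open>(g \<circ> p \<circ> inv g) \<circ> g = g \<circ> p\<close>; the contribution of
    \<open>p\<close> vanishes.\<close>
  have conj: "parity_at (Suc n) (g \<circ> p \<circ> inv\<^bsub>AutT\<^esub> g) (g t) \<longleftrightarrow>
      parity_at (Suc n) g (p t) \<noteq> parity_at (Suc n) g t"
    if g: "tree_aut g" and p: "p \<in> ?P" for g p t
  proof -
    have q: "tree_aut (g \<circ> p \<circ> inv\<^bsub>AutT\<^esub> g)"
      using g p by (intro tree_aut_comp tree_aut_inv_AutT) (auto dest: even_group_aut)
    have "(g \<circ> p \<circ> inv\<^bsub>AutT\<^esub> g) \<circ> g = g \<circ> p"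
      using inv_AutT_comp(2)[OF g] by (simp add: comp_assoc)
    then show ?thesis
      using parity_at_comp[OF q g, of "Suc n" t] parity_at_comp[OF g even_group_aut[OF p], of "Suc n" t] p
      by (auto simp: even_group_def)
  qed
  have conjP: "g \<circ> p \<circ> inv\<^bsub>AutT\<^esub> g \<in> ?P" if g: "g \<in> ?L" and p: "p \<in> ?P" for g p
  proof -
    have a: "tree_aut g" "tree_aut p" using g even_group_aut[OF p] by blast+
    have "\<not> parity_at (Suc n) (g \<circ> p \<circ> inv\<^bsub>AutT\<^esub> g) s" for s
    proof -
      define t where "t = (inv\<^bsub>AutT\<^esub> g) s"
      have s: "s = g t" using inv_AutT_comp(1)[OF a(1)] by (simp add: t_def fun_eq_iff)
      have "parity_at (Suc n) g (p t) = parity_at (Suc n) g t"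
        using g tree_aut_length[OF a(2)] by blast
      then show ?thesis unfolding s conj[OF a(1) p] by simp
    qed
    then show ?thesis
      using a by (simp add: even_group_def tree_aut_comp tree_aut_inv_AutT)
  qed
  have invL: "inv\<^bsub>AutT\<^esub> g \<in> ?L" if "g \<in> ?L" for g
  proof -
    have a: "tree_aut g" using that by blast
    have "parity_at (Suc n) (inv\<^bsub>AutT\<^esub> g) s = parity_at (Suc n) (inv\<^bsub>AutT\<^esub> g) t"
      if "length s = length t" for s t
    proof -
      have "length ((inv\<^bsub>AutT\<^esub> g) s) = length ((inv\<^bsub>AutT\<^esub> g) t)"
        using that by (simp add: tree_aut_length[OF tree_aut_inv_AutT[OF a]])
      then show ?thesis
        using \<open>g \<in> ?L\<close> unfolding parity_at_inv[OF a] by blast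
    qed
    then show ?thesis using tree_aut_inv_AutT[OF a] by blast
  qed
  show ?thesis
  proof (rule Set.set_eqI, rule iffI)
    fix g assume g: "g \<in> normalizer AutT ?P"
    then have a: "tree_aut g" unfolding norm by blast
    have "parity_at (Suc n) g s = parity_at (Suc n) g t" if st: "length s = length t" for s t
    proof -
      \<comment> \<open>Evenness of the conjugate of \<open>p\<close> compares the parities of
        \<open>g\<close> at \<open>s\<close> and at \<open>p s = t\<close>.\<close>
      obtain p where p: "p \<in> ?P" "p s = t" using even_group_level_transitive[OF st] .
      have "g \<circ> p \<circ> inv\<^bsub>AutT\<^esub> g \<in> ?P" using g p(1) by (auto simp: norm)
      then show ?thesis using conj[OF a p(1), of s] p(2) by (auto simp: even_group_def)
    qed
    then show "g \<in> ?L" using a by blast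
  next
    fix g assume g: "g \<in> ?L"
    then have a: "tree_aut g" by blast
    \<comment> \<open>Normalizing means equality of sets, so \<open>p\<close> must also have a
      preimage: its conjugate by the inverse of \<open>g\<close>.\<close>
    have "p \<in> (\<lambda>p. g \<circ> p \<circ> inv\<^bsub>AutT\<^esub> g) ` ?P" if p: "p \<in> ?P" for p
    proof
      have "inv\<^bsub>AutT\<^esub> (inv\<^bsub>AutT\<^esub> g) = g"
        using group.inv_inv[OF group_AutT] a by simp
      then show "inv\<^bsub>AutT\<^esub> g \<circ> p \<circ> g \<in> ?P" using conjP[OF invL[OF g] p] by simp
      show "p = g \<circ> (inv\<^bsub>AutT\<^esub> g \<circ> p \<circ> g) \<circ> inv\<^bsub>AutT\<^esub> g"
        using inv_AutT_comp(1)[OF a] by (simp add: fun_eq_iff)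
    qed
    then show "g \<in> normalizer AutT ?P" unfolding norm using a conjP[OF g] by blast
  qed
qed


section \<open>The generators\<close>

lemma nat_cases_1:
  fixes n :: nat
  assumes "1 \<le> n" obtains "n = Suc 0" | k where "1 \<le> k" "n = Suc k"
  using assms by (cases n; cases "n = Suc 0") auto

locale tree_generators =
  fixes r :: nat and a b :: "nat \<Rightarrow> bool list \<Rightarrow> bool list"
  assumes r_pos: "1 \<le> r" and recursion: "generator_recursion r a b"
begin

lemma a_aut: "1 \<le> i \<Longrightarrow> tree_aut (a i)"
  and b_aut: "1 \<le> j \<Longrightarrow> j \<le> r \<Longrightarrow> tree_aut (b j)"
  and a_1: "a (Suc 0) = tree_swap"
  and a_Suc_r: "a (Suc r) = tree_pair (a r) (b r)"
  and a_Suc: "1 \<le> i \<Longrightarrow> i \<noteq> r \<Longrightarrow> a (Suc i) = tree_pair (a i) id"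
  using recursion by (auto simp: generator_recursion_def)

lemma b_r_aut: "tree_aut (b r)" and a_r_aut: "tree_aut (a r)"
  using a_aut b_aut r_pos by auto

lemma b_1_inv: "b (Suc 0) = tree_pair (b r) (inv\<^bsub>AutT\<^esub> (b r)) \<circ> tree_swap"
  using recursion by (simp add: generator_recursion_def)

lemma b_Suc_inv:
  assumes "1 \<le> j" "Suc j \<le> r"
  shows "b (Suc j) = tree_pair (b r \<circ> b j \<circ> inv\<^bsub>AutT\<^esub> (b r)) id"
proof -
  have "\<forall>j. 1 < j \<and> j \<le> r \<longrightarrow>
      b j = tree_pair (b r \<circ> b (j - 1) \<circ> inv\<^bsub>AutT\<^esub> (b r)) id"
    using recursion unfolding generator_recursion_def AutT_simps by blast
  from this[rule_format, of "Suc j"] assms show ?thesis by simp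
qed

text \<open>In the square of \<open>b 1\<close>, moving the swap past the pair sets
  \<open>b r\<close> against its inverse, so the base case does not presuppose the claim for
  \<open>b r\<close>. Each later \<open>b j\<close> is a conjugate of its predecessor in the first
  coordinate.\<close>

lemma b_involution:
  assumes "1 \<le> j" "j \<le> r" shows "b j \<circ> b j = id"
  using assms
proof (induction j rule: nat_induct_at_least)
  case base
  have "b 1 \<circ> b 1 = tree_pair (b r) (inv\<^bsub>AutT\<^esub> (b r)) \<circ>
      (tree_swap \<circ> tree_pair (b r) (inv\<^bsub>AutT\<^esub> (b r))) \<circ> tree_swap"
    by (simp add: b_1_inv comp_assoc)
  also have "\<dots> = tree_pair (b r) (inv\<^bsub>AutT\<^esub> (b r)) \<circ>
      tree_pair (inv\<^bsub>AutT\<^esub> (b r)) (b r) \<circ> (tree_swap \<circ> tree_swap)"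
    by (simp only: tree_swap_pair comp_assoc)
  also have "\<dots> = id"
    by (simp add: tree_pair_comp inv_AutT_comp[OF b_r_aut])
  finally show ?case .
next
  case (Suc j)
  let ?u = "inv\<^bsub>AutT\<^esub> (b r)"
  have "(b r \<circ> b j \<circ> ?u) \<circ> (b r \<circ> b j \<circ> ?u) = b r \<circ> b j \<circ> (?u \<circ> b r) \<circ> b j \<circ> ?u"
    by (simp only: comp_assoc)
  also have "\<dots> = b r \<circ> (b j \<circ> b j) \<circ> ?u"
    by (simp only: inv_AutT_comp[OF b_r_aut] comp_id comp_assoc)
  also have "\<dots> = id"
    using Suc by (simp add: inv_AutT_comp[OF b_r_aut] del: o_apply id_apply)
  finally show ?case
    using Suc by (simp add: b_Suc_inv tree_pair_comp)
qed

lemma inv_b_r: "inv\<^bsub>AutT\<^esub> (b r) = b r"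
  using group.inv_equality[OF group_AutT, of "b r" "b r"] b_involution[of r] r_pos b_r_aut by simp

lemmas b_1 = b_1_inv[unfolded inv_b_r]
lemmas b_Suc = b_Suc_inv[unfolded inv_b_r]

section \<open>Parities of the generators\<close>

lemma section_b_1: "tree_section (b (Suc 0)) x = b r"
  unfolding b_1
  by (subst tree_section_comp) (auto simp: tree_aut_pair b_r_aut tree_aut_swap simp del: o_apply)

text \<open>\<open>b 1\<close> flips the root, and its equal sections cancel on deeper levels.
  Conjugation preserves parity, so from \<open>b j\<close> to \<open>b (Suc j)\<close> the odd level
  moves down by one.\<close>

lemma level_parity_b:
  assumes "1 \<le> j" "j \<le> r" shows "level_parity n (b j) \<longleftrightarrow> Suc n = j"
  using assms
proof (induction n arbitrary: j)
  case 0
  from 0(1) show ?case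
  proof (cases rule: nat_cases_1)
    case 1
    then show ?thesis
      using b_r_aut
      by (simp add: b_1 root_flip_comp tree_aut_pair tree_aut_swap del: o_apply)
  next
    case (2 k)
    then show ?thesis using 0 b_aut b_r_aut by (simp add: b_Suc)
  qed
next
  case (Suc n)
  from Suc.prems(1) show ?case
  proof (cases rule: nat_cases_1)
    case 1
    then show ?thesis by (simp add: section_b_1)
  next
    case (2 k)
    then have "tree_aut (b k)" using Suc.prems b_aut by simp
    then show ?thesis
      using 2 Suc b_r_aut
      by (simp add: b_Suc level_parity_comp tree_aut_comp del: o_apply id_apply) blast
  qed
qed

text \<open>In \<open>a (Suc r)\<close> the odd contributions of \<open>a r\<close> and
  \<open>b r\<close> on level \<open>r\<close> cancel, which makes all later \<open>a i\<close> even
  on every level.\<close>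

lemma level_parity_a:
  assumes "1 \<le> i" shows "level_parity n (a i) \<longleftrightarrow> Suc n = i \<and> i \<le> r"
  using assms
proof (induction n arbitrary: i)
  case 0
  from 0(1) show ?case
  proof (cases rule: nat_cases_1)
    case 1
    then show ?thesis using r_pos by (simp add: a_1)
  next
    case (2 k)
    then show ?thesis using a_aut[of k] a_r_aut by (cases "k = r") (simp_all add: a_Suc a_Suc_r)
  qed
next
  case (Suc n)
  from Suc.prems(1) show ?case
  proof (cases rule: nat_cases_1)
    case 1
    then show ?thesis by (simp add: a_1)
  next
    case (2 k)
    then show ?thesis
      using Suc.IH[of k] level_parity_b[of r n] r_pos
      by (cases "k = r") (auto simp: a_Suc a_Suc_r)
  qed
qed

lemma parity_at_generators:
  "(1 \<le> i \<longrightarrow> \<not> parity_at r (a i) t) \<and> (1 \<le> j \<and> j \<le> r \<longrightarrow> \<not> parity_at r (b j) t)"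
proof (induction "length t" arbitrary: t i j)
  case 0
  then show ?case by (auto simp: level_parity_a level_parity_b)
next
  case (Suc n)
  then obtain x s where t: "t = x # s" "length s = n" by (cases t) auto
  have IHa: "\<not> parity_at r (a k) s" if "1 \<le> k" for k
    using Suc.hyps(1) t(2) that by blast
  \<comment> \<open>All vertices of length \<open>n\<close> are covered because conjugation by
    \<open>b r\<close> moves the vertex at which the cocycle of \<open>b k\<close> is
    evaluated.\<close>
  have IHb: "\<not> parity_at r (b k) s'" if "1 \<le> k" "k \<le> r" "length s' = n" for k s'
    using Suc.hyps(1) that by blast
  show ?case
  proof (intro conjI impI)
    assume "1 \<le> i"
    then show "\<not> parity_at r (a i) t"
    proof (cases rule: nat_cases_1)
      case 1
      then show ?thesis by (simp add: a_1 t)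
    next
      case (2 k)
      then show ?thesis
        using IHa[of k] IHb[of r s] r_pos t
        by (cases "k = r") (simp_all add: a_Suc a_Suc_r)
    qed
  next
    assume j: "1 \<le> j \<and> j \<le> r"
    then have "1 \<le> j" ..
    then show "\<not> parity_at r (b j) t"
    proof (cases rule: nat_cases_1)
      case 1
      then show ?thesis using IHb[of r s] r_pos t by (simp add: section_b_1)
    next
      case (2 k)
      have k: "tree_aut (b k)" using 2 j b_aut by simp
      show ?thesis
        using 2 j t r_pos
        by (simp add: b_Suc parity_at_comp tree_aut_comp tree_aut_length k b_r_aut IHb del: o_apply)
    qed
  qed
qed

section \<open>The dense subgroup of \<open>G_group r a b\<close>\<close>

definition discrete_group :: "(bool list \<Rightarrow> bool list) set" where
  "discrete_group = generate AutT (a ` {1..} \<union> b ` {1..r})"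

lemma generators_even: "a ` {1..} \<union> b ` {1..r} \<subseteq> even_group r"
  using parity_at_generators by (auto simp: even_group_def a_aut b_aut)

lemma discrete_group_even: "discrete_group \<subseteq> even_group r"
  unfolding discrete_group_def
  by (rule group.generate_subgroup_incl[OF group_AutT generators_even subgroup_even_group])

lemma discrete_group_aut: "g \<in> discrete_group \<Longrightarrow> tree_aut g"
  using discrete_group_even even_group_aut by blast

lemma subgroup_discrete_group: "subgroup discrete_group AutT"
  unfolding discrete_group_def
  using generators_even even_group_aut by (intro group.generate_is_subgroup[OF group_AutT]) auto

lemma discrete_group_comp:
  "g \<in> discrete_group \<Longrightarrow> h \<in> discrete_group \<Longrightarrow> g \<circ> h \<in> discrete_group"
  using subgroup.m_closed[OF subgroup_discrete_group, of g h] by simp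

lemma a_in_discrete_group: "1 \<le> i \<Longrightarrow> a i \<in> discrete_group"
  unfolding discrete_group_def by (intro generate.incl) auto

lemma b_in_discrete_group: "1 \<le> j \<Longrightarrow> j \<le> r \<Longrightarrow> b j \<in> discrete_group"
  unfolding discrete_group_def by (intro generate.incl) auto

lemma swap_in_discrete_group: "tree_swap \<in> discrete_group"
  using a_in_discrete_group[of "Suc 0"] by (simp add: a_1)

text \<open>Exponents modulo 2 are truth values, like parities, so that adding them is exclusive
  or.\<close>

definition b_power :: "bool \<Rightarrow> bool list \<Rightarrow> bool list" where
  "b_power e = (if e then b r else id)"

lemma b_power_comp: "b_power d \<circ> b_power e = b_power (d \<noteq> e)"
  using b_involution[of r] r_pos by (auto simp: b_power_def)

lemma b_power_aut: "tree_aut (b_power e)"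
  by (simp add: b_power_def b_r_aut)

lemma pair_b_r: "tree_pair (b r) (b r) \<in> discrete_group"
  using discrete_group_comp[OF b_in_discrete_group[of "Suc 0"] swap_in_discrete_group] r_pos
  by (simp add: b_1 comp_assoc del: o_apply)

text \<open>The map \<open>x \<mapsto> (x, b\<^sub>r\<^sup>e)\<close>, where \<open>e\<close> is the parity of \<open>x\<close> on level \<open>r\<close>, is a homomorphism
  because \<open>b\<^sub>r\<close> is an involution, so it suffices to see where it sends the generators.\<close>

lemma discrete_group_lift:
  assumes "x \<in> discrete_group"
  shows "tree_pair x (b_power (level_parity (r - 1) x)) \<in> discrete_group"
proof -
  let ?p = "level_parity (r - 1)"
  let ?S = "{x. tree_aut x \<and> tree_pair x (b_power (?p x)) \<in> discrete_group}"
  have "subgroup ?S AutT"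
  proof
    show "?S \<subseteq> carrier AutT" by auto
    show "\<one>\<^bsub>AutT\<^esub> \<in> ?S"
      using subgroup.one_closed[OF subgroup_discrete_group] by (simp add: b_power_def)
  next
    fix x y assume xy: "x \<in> ?S" "y \<in> ?S"
    then have "tree_pair x (b_power (?p x)) \<circ> tree_pair y (b_power (?p y)) \<in> discrete_group"
      by (intro discrete_group_comp) auto
    then show "x \<otimes>\<^bsub>AutT\<^esub> y \<in> ?S"
      using xy by (simp add: tree_pair_comp b_power_comp level_parity_comp tree_aut_comp del: o_apply)
  next
    fix x assume x: "x \<in> ?S"
    let ?y = "inv\<^bsub>AutT\<^esub> x"
    have y: "tree_aut ?y" "x \<circ> ?y = id"
      using x by (simp_all add: tree_aut_inv_AutT inv_AutT_comp)
    have "?p ?y = ?p x" using level_parity_comp[of x ?y "r - 1"] x y by simp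
    moreover have "inv\<^bsub>AutT\<^esub> (tree_pair x (b_power (?p x))) = tree_pair ?y (b_power (?p x))"
      using x y by (intro group.inv_equality[OF group_AutT])
        (simp_all add: tree_pair_comp b_power_comp tree_aut_pair b_power_aut inv_AutT_comp,
          simp_all add: b_power_def)
    moreover have "inv\<^bsub>AutT\<^esub> (tree_pair x (b_power (?p x))) \<in> discrete_group"
      using x by (intro subgroup.m_inv_closed[OF subgroup_discrete_group]) auto
    ultimately show "?y \<in> ?S" using y(1) by simp
  qed
  moreover have "a ` {1..} \<union> b ` {1..r} \<subseteq> ?S"
  proof -
    have "a i \<in> ?S" if i: "1 \<le> i" for i
    proof (cases "i = r")
      case True
      \<comment> \<open>The lift of \<open>a r\<close> is exactly the generator
        \<open>a (Suc r)\<close>.\<close>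
      then have "?p (a i)" using level_parity_a[of r "r - 1"] r_pos by simp
      then show ?thesis
        using True a_in_discrete_group[of "Suc r"] a_r_aut by (simp add: b_power_def a_Suc_r)
    next
      case False
      then have "\<not> ?p (a i)" using level_parity_a[of i "r - 1"] r_pos i by simp
      then show ?thesis
        using False i a_in_discrete_group[of "Suc i"] a_aut by (simp add: b_power_def a_Suc)
    qed
    moreover have "b j \<in> ?S" if j: "1 \<le> j" "j \<le> r" for j
    proof (cases "j = r")
      case True
      then have "?p (b j)" using level_parity_b[of r "r - 1"] r_pos by simp
      then show ?thesis using True pair_b_r b_r_aut by (simp add: b_power_def)
    next
      case False
      then have np: "\<not> ?p (b j)" using level_parity_b[of j "r - 1"] r_pos j by simp
      \<comment> \<open>Conjugating by \<open>(b r, b r)\<close> undoes the conjugation by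
        \<open>b r\<close> in the recursion for \<open>b (Suc j)\<close>.\<close>
      have "tree_pair (b r) (b r) \<circ> b (Suc j) \<circ> tree_pair (b r) (b r) \<in> discrete_group"
        using j False by (intro discrete_group_comp pair_b_r b_in_discrete_group) auto
      also have "tree_pair (b r) (b r) \<circ> b (Suc j) \<circ> tree_pair (b r) (b r) =
          tree_pair ((b r \<circ> b r) \<circ> b j \<circ> (b r \<circ> b r)) (b r \<circ> b r)"
        using j False by (simp add: b_Suc tree_pair_comp comp_assoc)
      also have "\<dots> = tree_pair (b j) id"
        using b_involution[of r] r_pos by simp
      finally show ?thesis using np j b_aut by (simp add: b_power_def)
    qed
    ultimately show ?thesis by auto
  qed
  ultimately have "discrete_group \<subseteq> ?S"
    unfolding discrete_group_def by (intro group.generate_subgroup_incl[OF group_AutT])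
  then show ?thesis using assms by blast
qed

text \<open>If \<open>e\<close> is the power of \<open>b r\<close> given by the common parity, then
  (x, y) = (x, e)(e, e)(e, y). The outer factors come from lifts of \<open>x\<close> and
  \<open>y\<close>, the latter conjugated by the swap.\<close>

lemma discrete_group_pair:
  assumes x: "x \<in> discrete_group" and y: "y \<in> discrete_group"
    and "level_parity (r - 1) x \<longleftrightarrow> level_parity (r - 1) y"
  shows "tree_pair x y \<in> discrete_group"
proof -
  define e where "e = b_power (level_parity (r - 1) x)"
  have ee: "e \<circ> e = id" unfolding e_def b_power_comp by (simp add: b_power_def)
  have "tree_swap \<circ> tree_pair y e \<circ> tree_swap \<in> discrete_group"
    using discrete_group_lift[OF y] assms(3)
    by (intro discrete_group_comp swap_in_discrete_group) (simp add: e_def)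
  moreover have "tree_swap \<circ> tree_pair y e \<circ> tree_swap = tree_pair e y"
    by (simp add: tree_swap_pair comp_assoc del: o_apply)
  moreover have "tree_pair e e \<in> discrete_group"
    using pair_b_r subgroup.one_closed[OF subgroup_discrete_group] by (simp add: e_def b_power_def)
  moreover have "tree_pair x e \<in> discrete_group"
    using discrete_group_lift[OF x] by (simp add: e_def)
  ultimately have "tree_pair x e \<circ> tree_pair e e \<circ> tree_pair e y \<in> discrete_group"
    by (intro discrete_group_comp) simp_all
  then show ?thesis by (simp add: tree_pair_comp comp_assoc ee)
qed

section \<open>Density in the even group\<close>

lemma a_trivial: "1 \<le> i \<Longrightarrow> i \<le> r \<Longrightarrow> agree_upto (i - 1) id (a i)"
proof (induction i rule: nat_induct_at_least)
  case base
  then show ?case by (simp add: agree_upto_def a_1)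
next
  case (Suc i)
  then have "agree_upto (Suc (i - 1)) (tree_pair id id) (tree_pair (a i) id)"
    by (intro agree_upto_pair) (auto simp del: id_apply)
  then show ?case using Suc by (simp add: a_Suc del: id_apply)
qed

text \<open>Approximating both sections to depth \<open>n\<close> and matching their parities on
  level \<open>r\<close> makes \<open>discrete_group_pair\<close> applicable, which gains one
  level.\<close>

lemma even_group_approx:
  assumes "g \<in> even_group r" shows "\<exists>h\<in>discrete_group. agree_upto n g h"
  using assms
proof (induction n arbitrary: g)
  case 0
  then have "g [] = []" by (auto dest: even_group_aut)
  then show ?case
    using subgroup.one_closed[OF subgroup_discrete_group]
    by (intro bexI[of _ id]) (auto simp: agree_upto_def)
next
  case (Suc n)
  let ?p = "level_parity (r - 1)"
  have adjust: "\<exists>h\<in>discrete_group. agree_upto n u h \<and> ?p h = ?p u" if u: "u \<in> even_group r" for u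
  proof -
    obtain h where h: "h \<in> discrete_group" "agree_upto n u h" using Suc.IH[OF u] by blast
    show ?thesis
    proof (cases "?p h = ?p u")
      case False
      \<comment> \<open>Agreement to depth \<open>r\<close> would already determine the parity on
        level \<open>r\<close>.\<close>
      have n: "n \<le> r - 1"
      proof (rule ccontr)
        assume "\<not> n \<le> r - 1"
        then have "agree_upto (Suc (r - 1)) u h" using agree_upto_mono[OF h(2)] by simp
        then show False using False level_parity_agree by blast
      qed
      \<comment> \<open>\<open>a r\<close> is trivial to depth \<open>n\<close> but odd on level
        \<open>r\<close>, so multiplying by it repairs the parity.\<close>
      have "agree_upto n id (a r)" using agree_upto_mono[OF a_trivial n] r_pos by simp
      then have "agree_upto n (u \<circ> id) (h \<circ> a r)" using h(2) by (intro agree_upto_comp) auto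
      moreover have "?p (h \<circ> a r) = ?p u"
        using False level_parity_comp[OF discrete_group_aut[OF h(1)] a_r_aut, of "r - 1"]
          level_parity_a[of r "r - 1"] r_pos by auto
      moreover have "h \<circ> a r \<in> discrete_group"
        using h(1) a_in_discrete_group r_pos by (intro discrete_group_comp) auto
      ultimately show ?thesis by auto
    qed (use h in blast)
  qed
  have pair: "\<exists>h\<in>discrete_group. agree_upto (Suc n) (tree_pair u v) h"
    if u: "u \<in> even_group r" and v: "v \<in> even_group r" and uv: "?p u = ?p v" for u v
  proof -
    obtain h k where "h \<in> discrete_group" "agree_upto n u h" "?p h = ?p u"
      "k \<in> discrete_group" "agree_upto n v k" "?p k = ?p v"
      using adjust u v by metis
    then show ?thesis
      using uv by (intro bexI[of _ "tree_pair h k"] agree_upto_pair discrete_group_pair) auto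
  qed
  have g: "tree_aut g" using Suc.prems by (rule even_group_aut)
  \<comment> \<open>Writing \<open>r\<close> as \<open>Suc (r - 1)\<close> unfolds evenness at the
    root into equal parities of the two sections on level \<open>r\<close>.\<close>
  have "\<not> level_parity (Suc (r - 1)) g"
    using Suc.prems r_pos unfolding even_group_def by (auto dest: spec[of _ "[]"])
  then have sec: "?p (tree_section g False) = ?p (tree_section g True)" by simp
  note es = even_group_section[OF Suc.prems]
  show ?case
  proof (cases "root_flip g")
    case True
    obtain h where h: "h \<in> discrete_group"
      "agree_upto (Suc n) (tree_pair (tree_section g True) (tree_section g False)) h"
      using pair[OF es es] sec by metis
    have "agree_upto (Suc n) g (h \<circ> tree_swap)"
      using agree_upto_comp[OF h(2) agree_upto_refl tree_aut_swap]
      by (subst tree_aut_decompose[OF g]) (simp add: True)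
    then show ?thesis
      using discrete_group_comp[OF h(1) swap_in_discrete_group] by blast
  next
    case False
    then have "g = tree_pair (tree_section g False) (tree_section g True)"
      using tree_aut_decompose[OF g] by simp
    then show ?thesis using pair[OF es es sec] by metis
  qed
qed

lemma G_group_eq: "G_group r a b = even_group r"
proof
  show "G_group r a b \<subseteq> even_group r"
    unfolding G_group_def discrete_group_def[symmetric]
    by (rule even_group_closed[OF discrete_group_even])
  have "discrete_group \<subseteq> carrier AutT" using discrete_group_aut by auto
  then show "even_group r \<subseteq> G_group r a b"
    unfolding G_group_def discrete_group_def[symmetric]
    using even_group_approx even_group_aut by (auto simp: in_closure_AutT)
qed

lemma N_group_eq:
  "N_group r a b = {g. tree_aut g \<and>
     (\<forall>s t. length s = length t \<longrightarrow> parity_at r g s = parity_at r g t)}"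
  unfolding N_group_def G_group_eq using normalizer_even_group[of "r - 1"] r_pos by simp


section \<open>The elements \<open>w\<^sub>i\<close> and their infinite products\<close>

lemma w_elem_aut: "tree_aut (w_elem (b r) (Suc i))"
  by (induction i) (simp_all add: tree_aut_pair b_r_aut)

lemma w_elem_trivial: "agree_upto (Suc i) id (w_elem (b r) (Suc i))"
proof (induction i)
  case 0
  have "agree_upto (Suc 0) (tree_pair id id) (tree_pair id (b r))"
    using b_r_aut by (intro agree_upto_pair) (auto simp: agree_upto_def)
  then show ?case by (simp del: id_apply)
next
  case (Suc i)
  then have "agree_upto (Suc (Suc i)) (tree_pair id id)
      (tree_pair (w_elem (b r) (Suc i)) (w_elem (b r) (Suc i)))"
    by (intro agree_upto_pair)
  then show ?case by (simp del: id_apply)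
qed

lemma b_r_even: "\<not> parity_at r (b r) t"
  using parity_at_generators r_pos by blast

lemma level_parity_pair:
  "level_parity r (tree_pair u v) \<longleftrightarrow> level_parity (r - 1) u \<noteq> level_parity (r - 1) v"
  using r_pos by (cases r) simp_all

text \<open>In \<open>w_1 = (1, b r)\<close> the root sees the odd action of \<open>b r\<close> on
  level \<open>r\<close>, and both sections are even. In \<open>(w_i, w_i)\<close> the root parities
  cancel and all others move down one level.\<close>

lemma parity_at_w_elem: "parity_at r (w_elem (b r) (Suc i)) t \<longleftrightarrow> i = length t"
proof (induction i arbitrary: t)
  case 0
  show ?case
  proof (cases t)
    case Nil
    then show ?thesis using level_parity_b[of r "r - 1"] r_pos by (simp add: level_parity_pair)
  next
    case (Cons x s)
    then show ?thesis using b_r_even by simp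
  qed
next
  case (Suc i)
  show ?case
  proof (cases t)
    case Nil
    then show ?thesis by (simp add: level_parity_pair)
  next
    case (Cons x s)
    then show ?thesis using Suc by simp
  qed
qed

section \<open>Products with exponents in \<open>F2_product\<close>\<close>

lemma carrier_F2_product:
  "k \<in> carrier F2_product \<longleftrightarrow> (\<forall>i\<ge>1. k i = 0 \<or> k i = 1) \<and> k \<in> extensional {1..}"
proof -
  have "{0..<2} = {0, 1 :: int}" by auto
  then show ?thesis by (auto simp: carrier_integer_mod_group PiE_iff)
qed

context
  fixes k assumes k: "k \<in> carrier F2_product"
begin

lemma w_partial_product_Suc:
  "w_partial_product (b r) k (Suc n) =
     w_partial_product (b r) k n \<circ> (if k (Suc n) = 1 then w_elem (b r) (Suc n) else id)"
proof -
  have "k (Suc n) = 0 \<or> k (Suc n) = 1" using k unfolding carrier_F2_product by simp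
  then show ?thesis
    using group.int_pow_1[OF group_AutT, of "w_elem (b r) (Suc n)"] w_elem_aut[of n]
    by (auto simp del: w_elem.simps o_apply)
qed

lemma w_partial_product_aut: "tree_aut (w_partial_product (b r) k n)"
proof (induction n)
  case (Suc n)
  then show ?case
    unfolding w_partial_product_Suc using w_elem_aut by (intro tree_aut_comp) simp_all
qed (simp del: id_apply)

text \<open>The parities of a partial product depend on length alone, which automorphisms preserve,
  so the cocycle identity becomes plain addition. A vertex of length \<open>l\<close> detects the
  exponent at \<open>l + 1\<close>.\<close>

lemma parity_at_w_partial_product:
  "parity_at r (w_partial_product (b r) k n) t \<longleftrightarrow> length t < n \<and> k (Suc (length t)) = 1"
proof (induction n arbitrary: t)
  case (Suc n)
  have "parity_at r (if k (Suc n) = 1 then w_elem (b r) (Suc n) else id) t \<longleftrightarrow>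
      k (Suc n) = 1 \<and> n = length t"
    by (auto simp: parity_at_w_elem simp del: w_elem.simps)
  moreover have w: "tree_aut (if k (Suc n) = 1 then w_elem (b r) (Suc n) else id)"
    using w_elem_aut by simp
  ultimately show ?case
    unfolding w_partial_product_Suc parity_at_comp[OF w_partial_product_aut w] Suc.IH
      tree_aut_length[OF w] by (cases "length t = n") auto
qed simp

lemma w_partial_product_agree:
  assumes "n \<le> m"
  shows "agree_upto n (w_partial_product (b r) k n) (w_partial_product (b r) k m)"
  using assms
proof (induction m rule: dec_induct)
  case (step m)
  let ?w = "if k (Suc m) = 1 then w_elem (b r) (Suc m) else id"
  have "agree_upto n id ?w"
    using agree_upto_mono[OF w_elem_trivial[of m], of n] step.hyps by (simp del: w_elem.simps)
  then have "agree_upto n (w_partial_product (b r) k n \<circ> id) (w_partial_product (b r) k (Suc m))"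
    unfolding w_partial_product_Suc using step.IH by (intro agree_upto_comp) simp_all
  then show ?case by (simp only: comp_id)
qed simp

lemma limitin_w_product:
  "limitin AutT_topology (w_partial_product (b r) k) (w_product (b r) k) sequentially"
proof -
  \<comment> \<open>The value at \<open>t\<close> is final from index \<open>length t\<close> on,
    since later factors fix words of that length.\<close>
  define L where "L t = w_partial_product (b r) k (length t) t" for t
  have LP: "L t = w_partial_product (b r) k n t" if "length t \<le> n" for t n
    using w_partial_product_agree[OF that] by (simp add: agree_upto_def L_def)
  have L: "tree_aut L"
  proof (rule tree_autI)
    show "L [] = []" by (simp add: L_def)
    show "\<exists>y. L (t @ [x]) = L t @ [y]" for t x
      using tree_aut_child[OF w_partial_product_aut, of "Suc (length t)" t x]
        LP[of t "Suc (length t)"] LP[of "t @ [x]" "Suc (length t)"] by simp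
    show "inj L"
    proof (rule injI)
      fix s t assume "L s = L t"
      then show "s = t"
        using LP[of s "max (length s) (length t)"] LP[of t "max (length s) (length t)"]
          tree_aut_inj[OF w_partial_product_aut] by simp
    qed
  qed
  have "agree_upto n L (w_partial_product (b r) k m)" if "n \<le> m" for n m
    unfolding agree_upto_def
  proof (intro allI impI)
    fix t :: "bool list" assume "length t \<le> n"
    with that have "length t \<le> m" by simp
    then show "L t = w_partial_product (b r) k m t" by (rule LP)
  qed
  then have lim: "limitin AutT_topology (w_partial_product (b r) k) L sequentially"
    unfolding limitin_AutT using L w_partial_product_aut eventually_sequentially by auto
  then have "w_product (b r) k = L"
    unfolding w_product_def by (blast intro: limitin_AutT_unique)
  then show ?thesis using lim by simp
qed

lemma w_product_aut: "tree_aut (w_product (b r) k)"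
  using limitin_w_product by (simp add: limitin_AutT)

text \<open>Depth \<open>length t + r + 1\<close> determines the parity at \<open>t\<close>, and
  there the limit agrees with late partial products.\<close>

lemma parity_at_w_product:
  "parity_at r (w_product (b r) k) t \<longleftrightarrow> k (Suc (length t)) = 1"
proof -
  have "\<forall>\<^sub>F m in sequentially. length t < m \<and>
      agree_upto (Suc (length t + r)) (w_product (b r) k) (w_partial_product (b r) k m)"
    using limitin_w_product unfolding limitin_AutT
    by (auto simp: eventually_conj_iff eventually_gt_at_top elim: eventually_mono)
  then obtain m where m: "length t < m"
    "agree_upto (Suc (length t + r)) (w_product (b r) k) (w_partial_product (b r) k m)"
    using eventually_happens'[OF sequentially_bot] by blast
  then show ?thesis
    using parity_at_agree[OF m(2)] parity_at_w_partial_product by simp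
qed

lemma w_product_in_N: "w_product (b r) k \<in> N_group r a b"
  by (simp add: N_group_eq w_product_aut parity_at_w_product)

end

section \<open>The quotient \<open>N(r)/G(r)\<close>\<close>

abbreviation N_monoid :: "(bool list \<Rightarrow> bool list) monoid" where
  "N_monoid \<equiv> AutT\<lparr>carrier := N_group r a b\<rparr>"

lemma normal_G: "G_group r a b \<lhd> N_monoid"
  unfolding N_group_def G_group_eq
  by (rule group.subgroup_in_normalizer[OF group_AutT subgroup_even_group])

text \<open>Left multiplication by an even element leaves the cocycle unchanged; conversely, equal
  cocycles cancel in \<open>g \<circ> inv h\<close>.\<close>

lemma r_coset_eq_iff:
  assumes g: "g \<in> N_group r a b" and h: "h \<in> N_group r a b"
  shows "G_group r a b #>\<^bsub>N_monoid\<^esub> g = G_group r a b #>\<^bsub>N_monoid\<^esub> h \<longleftrightarrow>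
    (\<forall>t. parity_at r g t = parity_at r h t)" (is "?L \<longleftrightarrow> ?R")
proof
  have aut: "tree_aut g" "tree_aut h" using g h unfolding N_group_eq by blast+
  note G = normal_imp_subgroup[OF normal_G]
  have N: "group N_monoid" using normal_G by (simp add: normal_def)
  {
    assume ?L
    then have "g \<in> G_group r a b #>\<^bsub>N_monoid\<^esub> h"
      using group.rcos_self[OF N _ G] g by auto
    then obtain p where p: "p \<in> even_group r" "g = p \<circ> h"
      by (auto simp: r_coset_def G_group_eq)
    then show ?R
      using parity_at_comp[OF even_group_aut[OF p(1)] aut(2), of r] by (auto simp: even_group_def)
  next
    assume R: ?R
    let ?p = "g \<circ> inv\<^bsub>AutT\<^esub> h"
    have "\<not> parity_at r ?p t" for t
      using R aut by (simp add: parity_at_comp parity_at_inv tree_aut_inv_AutT del: o_apply)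
    then have "?p \<in> even_group r"
      using aut by (simp add: even_group_def tree_aut_comp tree_aut_inv_AutT)
    moreover have "g = ?p \<circ> h" using inv_AutT_comp(2)[OF aut(2)] by (simp add: comp_assoc)
    ultimately have "g \<in> G_group r a b #>\<^bsub>N_monoid\<^esub> h"
      unfolding r_coset_def G_group_eq by auto
    then show ?L
      using group.repr_independence[OF N _ _ G] h by auto
  }
qed

lemma w_product_iso:
  "(\<lambda>k. G_group r a b #>\<^bsub>N_monoid\<^esub> w_product (b r) k) \<in> iso F2_product (N_monoid Mod G_group r a b)"
proof -
  let ?G = "G_group r a b" and ?\<phi> = "w_product (b r)"
  let ?f = "\<lambda>k. ?G #>\<^bsub>N_monoid\<^esub> ?\<phi> k"
  have carr: "carrier (N_monoid Mod ?G) = (\<lambda>g. ?G #>\<^bsub>N_monoid\<^esub> g) ` N_group r a b"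
    by (auto simp: FactGroup_def RCOSETS_def)
  have hom: "?f \<in> hom F2_product (N_monoid Mod ?G)"
  proof (rule homI)
    fix k assume k: "k \<in> carrier F2_product"
    show "?f k \<in> carrier (N_monoid Mod ?G)"
      unfolding carr using w_product_in_N[OF k] by blast
  next
    fix k l assume k: "k \<in> carrier F2_product" and l: "l \<in> carrier F2_product"
    let ?m = "k \<otimes>\<^bsub>F2_product\<^esub> l"
    have m_eq: "?m i = (k i + l i) mod 2" if "1 \<le> i" for i
      using that by (simp add: product_group_def)
    have bit: "k i = 0 \<or> k i = 1" "l i = 0 \<or> l i = 1" if "1 \<le> i" for i
      using k l that unfolding carrier_F2_product by auto
    have m: "?m \<in> carrier F2_product"
      unfolding carrier_F2_product using m_eq by (auto simp: product_group_def)
    have kl: "?\<phi> k \<circ> ?\<phi> l \<in> N_group r a b"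
      using k l by (auto simp: N_group_eq tree_aut_comp w_product_aut parity_at_comp
          parity_at_w_product tree_aut_length[OF w_product_aut] simp del: o_apply)
    \<comment> \<open>\<open>?\<phi> l\<close> preserves length and the parities of
      \<open>?\<phi> k\<close> depend only on length, so the exponents add modulo 2.\<close>
    have "parity_at r (?\<phi> ?m) t = parity_at r (?\<phi> k \<circ> ?\<phi> l) t" for t
    proof -
      have "parity_at r (?\<phi> k \<circ> ?\<phi> l) t \<longleftrightarrow>
          (k (Suc (length t)) = 1) \<noteq> (l (Suc (length t)) = 1)"
        using k l by (simp add: parity_at_comp w_product_aut parity_at_w_product
            tree_aut_length[OF w_product_aut] del: o_apply)
      then show ?thesis
        unfolding parity_at_w_product[OF m]
        using m_eq[of "Suc (length t)"] bit[of "Suc (length t)"] by auto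
    qed
    then have "?f ?m = ?G #>\<^bsub>N_monoid\<^esub> (?\<phi> k \<circ> ?\<phi> l)"
      using r_coset_eq_iff[OF w_product_in_N[OF m] kl] by blast
    also have "\<dots> = ?f k <#>\<^bsub>N_monoid\<^esub> ?f l"
      using normal.rcos_sum[OF normal_G, of "?\<phi> k" "?\<phi> l"] w_product_in_N[OF k] w_product_in_N[OF l]
      by simp
    finally show "?f ?m = ?f k \<otimes>\<^bsub>N_monoid Mod ?G\<^esub> ?f l"
      by (simp add: FactGroup_def)
  qed
  have "inj_on ?f (carrier F2_product)"
  proof (rule inj_onI)
    fix k l assume k: "k \<in> carrier F2_product" and l: "l \<in> carrier F2_product" and "?f k = ?f l"
    then have "\<forall>t. parity_at r (?\<phi> k) t = parity_at r (?\<phi> l) t"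
      using r_coset_eq_iff[OF w_product_in_N[OF k] w_product_in_N[OF l]] by blast
    then have eq: "k (Suc (length t)) = 1 \<longleftrightarrow> l (Suc (length t)) = 1" for t :: "bool list"
      unfolding parity_at_w_product[OF k] parity_at_w_product[OF l] by blast
    show "k = l"
    proof (rule extensionalityI[of _ "{1..}"])
      \<comment> \<open>Any vertex of length \<open>i - 1\<close> detects the exponent at
        \<open>i\<close>; the word of zeros serves.\<close>
      fix i :: nat assume "i \<in> {1..}"
      then show "k i = l i"
        using eq[of "replicate (i - 1) False"] k l unfolding carrier_F2_product by fastforce
    qed (use k l carrier_F2_product in blast)+
  qed
  moreover have "carrier (N_monoid Mod ?G) \<subseteq> ?f ` carrier F2_product"
  proof
    fix C assume "C \<in> carrier (N_monoid Mod ?G)"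
    then obtain g where g: "g \<in> N_group r a b" "C = ?G #>\<^bsub>N_monoid\<^esub> g" unfolding carr by blast
    \<comment> \<open>The exponents are read off along the words of zeros, which represent their
      levels because \<open>g\<close> lies in the normalizer. Restriction to \<open>{1..}\<close>
      makes \<open>k\<close> extensional.\<close>
    define k where "k = (\<lambda>i\<in>{1..}. of_bool (parity_at r g (replicate (i - 1) False)) :: int)"
    have k: "k \<in> carrier F2_product" by (auto simp: carrier_F2_product k_def)
    have "parity_at r g t = parity_at r (?\<phi> k) t" for t
    proof -
      have "parity_at r g t = parity_at r g (replicate (length t) False)"
        using g(1) unfolding N_group_eq mem_Collect_eq by (metis length_replicate)
      then show ?thesis unfolding parity_at_w_product[OF k] by (simp add: k_def)
    qed
    then have "C = ?f k" using r_coset_eq_iff[OF g(1) w_product_in_N[OF k]] g(2) by blast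
    then show "C \<in> ?f ` carrier F2_product" using k by blast
  qed
  moreover have "?f ` carrier F2_product \<subseteq> carrier (N_monoid Mod ?G)"
    using hom by (auto simp: hom_def)
  ultimately show ?thesis
    using hom by (auto simp: iso_def bij_betw_def)
qed

end

theorem theorem4p6p10:
  fixes r :: nat and a b :: "nat \<Rightarrow> bool list \<Rightarrow> bool list"
  assumes "r \<ge> 1" and "generator_recursion r a b"
  shows "(\<forall>k\<in>carrier F2_product.
            limitin AutT_topology (w_partial_product (b r) k) (w_product (b r) k) sequentially \<and>
            w_product (b r) k \<in> N_group r a b) \<and>
         (\<lambda>k. G_group r a b #>\<^bsub>AutT\<lparr>carrier := N_group r a b\<rparr>\<^esub> w_product (b r) k)
           \<in> iso F2_product (AutT\<lparr>carrier := N_group r a b\<rparr> Mod G_group r a b)"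
proof -
  interpret tree_generators r a b using assms by unfold_locales
  show ?thesis using limitin_w_product w_product_in_N w_product_iso by blast
qed

end
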